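(* Let $\alpha\in(0,2)$, let $\Omega=(a_x,b_x)\times(a_y,b_y)\times(a_z,b_z)\subset\mathbb{R}^3$ be a bounded box, and let $u:\mathbb{R}^3\to\mathbb{R}$ satisfy $u=0$ on $\mathbb{R}^3\setminus\Omega$. Let $0<\varepsilon\le 1+\lfloor\alpha\rfloor-\alpha$ and assume $u\in C^{2+\lfloor\alpha\rfloor,\,\alpha-\lfloor\alpha\rfloor+\varepsilon}(\mathbb{R}^3)$. Then with splitting parameter $\gamma=2$ there is a constant $C>0$ independent of $h$ such that, for all sufficiently small $h=L/N$, $$\sup_{\mathbf{x}\in\Omega}\big|(-\Delta)^{\alpha/2}u(\mathbf{x})-(-\Delta)^{\alpha/2}_{h,2}u(\mathbf{x})\big|\le C h^{2}.$$
   Context: $\lfloor\cdot\rfloor$ is the floor function. For $k\in\mathbb{N}_0$, $s\in(0,1]$, $C^{k,s}(\mathbb{R}^d)$ is the space of functions $\mathbb{R}^d\to\mathbb{R}$ with continuous partial derivatives of all orders $\le k$ whose $k$-th order partial derivatives are uniformly Hölder continuous with exponent $s$. The fractional Laplacian is $(-\Delta)^{\alpha/2}u(\mathbf{x})=c_{d,\alpha}\,\mathrm{P.V.}\int_{\mathbb{R}^d}\frac{u(\mathbf{x})-u(\mathbf{x}')}{|\mathbf{x}-\mathbf{x}'|^{d+\alpha}}\,d\mathbf{x}'$ with $c_{d,\alpha}=\frac{2^{\alpha-1}\alpha\,\Gamma((d+\alpha)/2)}{\pi^{d/2}\Gamma(1-\alpha/2)}$. Three-dimensional discrete operator: let $L=\max\{b_x-a_x,b_y-a_y,b_z-a_z\}$,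 $N$ a positive integer, $h=L/N$, $\boldsymbol{\xi}_{ijk}=(ih,jh,kh)$, $I_{ijk}=[ih,(i+1)h]\times[jh,(j+1)h]\times[kh,(k+1)h]$, $D_1=(0,L)^3$, $D_2=[0,\infty)^3\setminus D_1$. For $\mathbf{x}=(x,y,z)$, $\boldsymbol{\xi}=(\xi,\eta,\zeta)\in[0,\infty)^3\setminus\{0\}$ set $\psi_\gamma(\mathbf{x},\boldsymbol{\xi})=|\boldsymbol{\xi}|^{-\gamma}\Big(\sum_{m,n,s\in\{0,1\}}u(x+(-1)^m\xi,\,y+(-1)^n\eta,\,z+(-1)^s\zeta)-8u(\mathbf{x})\Big)$ and $\omega_\gamma(\boldsymbol{\xi})=|\boldsymbol{\xi}|^{\gamma-(3+\alpha)}$. For $(m,n,s)\in\{0,1\}^3\setminus\{(0,0,0)\}$ let $c^\gamma_{mns}=1$ if $\gamma\in(\alpha,2)$; if $\gamma=2$, $c^2_{mns}=8/3$ when $m+n+s=1$ and $c^2_{mns}=0$ when $m+n+s>1$. Define, for $\mathbf{x}\in\Omega$, $$(-\Delta)^{\alpha/2}_{h,\gamma}u(\mathbf{x})=-c_{3,\alpha}\Big[\tfrac18\Big(\sum_{(m,n,s)\ne(0,0,0)}c^\gamma_{mns}\psi_\gamma(\mathbf{x},\boldsymbol{\xi}_{mns})\Big)\int_{I_{000}}\omega_\gamma\,d\boldsymbol{\xi}+\tfrac18\sum_{\substack{0\le i,j,k\le N-1\\(i,j,k)\ne(0,0,0)}}\Big(\sum_{m,n,s\in\{0,1\}}\psi_\gamma(\mathbf{x},\boldsymbol{\xi}_{(i+m)(j+n)(k+s)})\Big)\int_{I_{ijk}}\omega_\gamma\,d\boldsymbol{\xi}-8u(\mathbf{x})\int_{D_2}|\boldsymbol{\xi}|^{-(3+\alpha)}d\boldsymbol{\xi}\Big].$$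 *)

theory Defs
  imports "HOL-Analysis.Analysis"
begin

definition pt3 :: "real \<Rightarrow> real \<Rightarrow> real \<Rightarrow> real^3" where
  "pt3 a b c = vector [a, b, c]"

fun pd :: "3 list \<Rightarrow> (real^3 \<Rightarrow> real) \<Rightarrow> real^3 \<Rightarrow> real" where
  "pd [] f = f"
| "pd (i # is) f = (\<lambda>x. deriv (\<lambda>t. pd is f (x + t *\<^sub>R axis i 1)) 0)"

definition holder_C :: "nat \<Rightarrow> real \<Rightarrow> (real^3 \<Rightarrow> real) set" where
  "holder_C k s = {f.
     (\<forall>is i x. length is < k \<longrightarrow>
        (\<lambda>t. pd is f (x + t *\<^sub>R axis i 1)) field_differentiable (at 0)) \<and>
     (\<forall>is. length is \<le> k \<longrightarrow> continuous_on UNIV (pd is f)) \<and>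
     (\<forall>is. length is = k \<longrightarrow>
        (\<exists>K. \<forall>x y. \<bar>pd is f x - pd is f y\<bar> \<le> K * dist x y powr s))}"

definition c_const :: "real \<Rightarrow> real" where
  "c_const \<alpha> = 2 powr (\<alpha> - 1) * \<alpha> * Gamma ((3 + \<alpha>) / 2) / (pi powr (3/2) * Gamma (1 - \<alpha> / 2))"

definition frac_lap :: "real \<Rightarrow> (real^3 \<Rightarrow> real) \<Rightarrow> real^3 \<Rightarrow> real" where
  "frac_lap \<alpha> u x = c_const \<alpha> *
     Lim (at_right 0) (\<lambda>e. set_lebesgue_integral lborel {y. e \<le> dist x y}
           (\<lambda>y. (u x - u y) / dist x y powr (3 + \<alpha>)))"

definition psi :: "real \<Rightarrow> (real^3 \<Rightarrow> real) \<Rightarrow> real^3 \<Rightarrow> real^3 \<Rightarrow> real" where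
  "psi \<gamma> u x \<xi> = norm \<xi> powr (- \<gamma>) *
     ((\<Sum>m\<in>{0,1::nat}. \<Sum>n\<in>{0,1::nat}. \<Sum>s\<in>{0,1::nat}.
         u (pt3 (x$1 + (-1)^m * \<xi>$1) (x$2 + (-1)^n * \<xi>$2) (x$3 + (-1)^s * \<xi>$3)))
      - 8 * u x)"

definition omega :: "real \<Rightarrow> real \<Rightarrow> real^3 \<Rightarrow> real" where
  "omega \<alpha> \<gamma> \<xi> = norm \<xi> powr (\<gamma> - (3 + \<alpha>))"

text \<open>Coefficients c^gamma_{mns}: 1 for gamma in (alpha,2); for gamma = 2 as in the paper.\<close>
definition ccoef :: "real \<Rightarrow> nat \<Rightarrow> nat \<Rightarrow> nat \<Rightarrow> real" where
  "ccoef \<gamma> m n s = (if \<gamma> = 2 then (if m + n + s = 1 then 8/3 else 0) else 1)"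

definition grid :: "real \<Rightarrow> nat \<Rightarrow> nat \<Rightarrow> nat \<Rightarrow> real^3" where
  "grid h i j k = pt3 (real i * h) (real j * h) (real k * h)"

definition cell :: "real \<Rightarrow> nat \<Rightarrow> nat \<Rightarrow> nat \<Rightarrow> (real^3) set" where
  "cell h i j k = cbox (grid h i j k) (grid h (i+1) (j+1) (k+1))"

definition D2 :: "real \<Rightarrow> (real^3) set" where
  "D2 L = {\<xi>. \<forall>i. 0 \<le> \<xi>$i} - box 0 (pt3 L L L)"

definition frac_lap_h :: "real \<Rightarrow> real \<Rightarrow> real \<Rightarrow> nat \<Rightarrow> (real^3 \<Rightarrow> real) \<Rightarrow> real^3 \<Rightarrow> real" where
  "frac_lap_h \<alpha> \<gamma> L N u x = (let h = L / real N in
     - c_const \<alpha> *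
       (1/8 * (\<Sum>(m,n,s)\<in>({0,1}\<times>{0,1}\<times>{0,1}) - {(0,0,0)}.
                 ccoef \<gamma> m n s * psi \<gamma> u x (grid h m n s))
            * set_lebesgue_integral lborel (cell h 0 0 0) (omega \<alpha> \<gamma>)
        + 1/8 * (\<Sum>(i,j,k)\<in>({0..<N}\<times>{0..<N}\<times>{0..<N}) - {(0,0,0)}.
                 (\<Sum>m\<in>{0,1::nat}. \<Sum>n\<in>{0,1::nat}. \<Sum>s\<in>{0,1::nat}.
                     psi \<gamma> u x (grid h (i+m) (j+n) (k+s)))
                 * set_lebesgue_integral lborel (cell h i j k) (omega \<alpha> \<gamma>))
        - 8 * u x * set_lebesgue_integral lborel (D2 L) (\<lambda>\<xi>. norm \<xi> powr (- (3 + \<alpha>)))))"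

end

theory Submission
  imports Defs
begin

text \<open>
  Folding the singular integral onto the positive octant turns the principal value into the
  integral of \<open>\<psi> \<omega>\<close>, where \<open>|\<xi>|\<^sup>2 \<psi>\<close> is the sum of \<open>u\<close> over the eight reflected points minus
  \<open>8 u(x)\<close>. Its Taylor expansion at 0 has no linear and no mixed quadratic terms, so
  \<open>\<psi> = \<Sum>\<^sub>i 4 \<partial>\<^sub>i\<^sub>i u(x) \<xi>\<^sub>i\<^sup>2 / |\<xi>|\<^sup>2 + \<phi>\<close>. The quadratic part is too rough for a second-order
  bound cell by cell, but the rule is exact on it: by cyclic symmetry the three functions
  \<open>\<xi>\<^sub>i\<^sup>2 / |\<xi>|\<^sup>2\<close> contribute equally, and they sum to 1. The remainder satisfies
  \<open>\<phi> = O(|\<xi>|\<^sup>s)\<close> with \<open>s = \<alpha> + \<epsilon>\<close>, with each derivative costing one power of \<open>|\<xi>|\<close>, and a midpoint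
  expansion in a cell away from 0 bounds the error there by
  \<open>O(h\<^sup>2)\<close> times the integral of \<open>|\<xi>|\<close> to the power \<open>\<epsilon> - 3\<close>. This is integrable at 0.
\<close>

section \<open>Power integrals and isometries on three-space\<close>

text \<open>Why the quadratic part needs exactness: its quotient by |\<xi>|^2 is homogeneous of
  degree 0 and has second derivatives of order |\<xi>|^(-2). Against the weight
  |\<xi>|^(-1-\<alpha>), a cellwise expansion would cost h^2 |\<xi>|^(-3-\<alpha>), which is not
  integrable at 0; summed over |\<xi>| >= h it gives only h^(2-\<alpha>). For \<phi> the
  corresponding power is (\<alpha>+\<epsilon>-2) + (-1-\<alpha>) = \<epsilon>-3. The product of the
  gradient of \<phi> with the derivative of the weight has the same order, since
  (\<alpha>+\<epsilon>-1) + (-2-\<alpha>) = \<epsilon>-3. In the cell at the origin no expansion is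
  possible; there integral and rule are each small enough on their own. Every other cell has its
  centre at distance at least 3h/2 from 0 and half-diagonal below h, so it stays in the region where
  \<phi> can be expanded. All constants come from Hoelder constants of u on the whole space, so they
  do not depend on x and the final bound is uniform. Numerical constants are rounded up
  generously.\<close>

lemma integrable_lborel_vec3_prod:
  fixes f :: "real \<Rightarrow> real"
  assumes f: "integrable lborel f" and nn: "\<And>t. 0 \<le> f t"
  shows "integrable lborel (\<lambda>z::real^3. f (z$1) * f (z$2) * f (z$3))"
proof -
  have [measurable]: "f \<in> borel_measurable borel" using f by auto
  have B: "(\<Prod>b\<in>Basis. f (z \<bullet> b)) = f (z$1) * f (z$2) * f (z$3)" for z :: "real^3"
  proof -
    have B: "(Basis::(real^3) set) = range (\<lambda>i. axis i 1)"
      by (auto simp: Basis_vec_def)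
    have inj: "inj (\<lambda>i::3. axis i (1::real))"
      by (rule injI) (simp add: axis_eq_axis)
    have "(\<Prod>b\<in>(Basis::(real^3) set). f (z \<bullet> b)) = (\<Prod>i\<in>UNIV. f (z \<bullet> axis i 1))"
      unfolding B prod.reindex[OF inj] by simp
    also have "\<dots> = (\<Prod>i\<in>UNIV. f (z$i))"
      by (simp only: inner_axis inner_real_def mult_1_right)
    also have "\<dots> = f (z$1) * f (z$2) * f (z$3)"
      unfolding UNIV_3 by (simp add: ac_simps)
    finally show ?thesis .
  qed
  have "(\<integral>\<^sup>+z. (\<Prod>b\<in>(Basis::(real^3) set). ennreal (f (z \<bullet> b))) \<partial>lborel)
      = (\<Prod>b\<in>(Basis::(real^3) set). (\<integral>\<^sup>+t. ennreal (f t) \<partial>lborel))"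
    by (rule nn_integral_lborel_prod) auto
  also have "\<dots> < \<infinity>"
  proof -
    have "(\<integral>\<^sup>+t. ennreal (f t) \<partial>lborel) < \<infinity>"
      using f nn by (simp add: integrable_iff_bounded)
    then show ?thesis by (simp add: less_top[symmetric] power_eq_top_ennreal)
  qed
  finally have "(\<integral>\<^sup>+z. ennreal (f (z$1) * f (z$2) * f ((z::real^3)$3)) \<partial>lborel) < \<infinity>"
    by (simp add: prod_ennreal nn B)
  then show ?thesis
    by (intro integrableI_bounded) (auto simp: nn)
qed

lemma integrable_lborel_even:
  fixes f :: "real \<Rightarrow> real"
  assumes f: "set_integrable lborel {0<..} f" and even: "\<And>t. f (- t) = f t"
    and [measurable]: "f \<in> borel_measurable borel"
  shows "integrable lborel f"
proof -
  have 1: "integrable lborel (\<lambda>t. indicator {0<..} t *\<^sub>R f t)"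
    using f by (simp add: set_integrable_def)
  have "integrable lborel (\<lambda>t. indicator {0<..} (0 + (-1)*t) *\<^sub>R f (0 + (-1) * t))"
    by (rule lborel_integrable_real_affine[OF 1]) simp
  then have 2: "integrable lborel (\<lambda>t. indicator {0<..} (-t) *\<^sub>R f t)"
    by (simp add: even)
  have "integrable lborel (\<lambda>t. indicator {0<..} t *\<^sub>R f t + indicator {0<..} (-t) *\<^sub>R f t)"
    by (rule Bochner_Integration.integrable_add[OF 1 2])
  then show ?thesis
  proof (rule integrable_cong_AE_imp)
    show "AE t in lborel. indicator {0<..} t *\<^sub>R f t + indicator {0<..} (-t) *\<^sub>R f t = f t"
      using AE_lborel_singleton[of "0::real"] by eventually_elim (auto simp: indicator_def)
  qed simp
qed

text \<open>Closed octants, closed grid cells and the closed cube overlap only on coordinate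
  hyperplanes. This discards all of them at once; a countable set is allowed so that all multiples
  of the mesh size are covered.\<close>

lemma AE_lborel_component_notin_countable:
  fixes A :: "real set"
  assumes "countable A"
  shows "AE z in lborel. \<forall>i. (z::real^'n)$i \<notin> A"
proof -
  have "AE z in lborel. (z::real^'n)$i \<noteq> a" for i a
  proof -
    have "{z::real^'n. z$i = a} \<in> null_sets lebesgue"
      using negligible_standard_hyperplane[of "axis i 1 :: real^'n" a]
      by (simp add: negligible_iff_null_sets inner_axis axis_in_Basis_iff)
    then have "AE z in lebesgue. z \<notin> {z::real^'n. z$i = a}" by (rule AE_not_in)
    then show ?thesis by (simp add: AE_completion_iff)
  qed
  then have "AE z in lborel. \<forall>a\<in>A. (z::real^'n)$i \<noteq> a" for i
    using assms by (simp add: AE_ball_countable)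
  then have "AE z in lborel. (z::real^'n)$i \<notin> A" for i
    by (rule AE_mp) (auto intro!: AE_I2)
  then show ?thesis using AE_finite_allI[where S="UNIV::'n set" and M=lborel and Q="\<lambda>i z. z$i \<notin> A"] by simp
qed

text \<open>Replaces spherical coordinates by a product: |z_i| <= |z| gives |z|^(-a) <= the product
  of the three |z_i|^(-a/3), and a/3 < 1 makes each factor integrable at 0. The comparison needs
  nonzero components, since \<open>0 powr p = 0\<close>, hence the almost-everywhere
  argument.\<close>

lemma integrable_norm_powr_near_0:
  fixes r a :: real
  assumes "0 \<le> a" "a < 3"
  shows "set_integrable lborel {z::real^3. norm z \<le> r} (\<lambda>z. norm z powr (- a))"
proof (cases "0 \<le> r")
  case False
  then have "{z::real^3. norm z \<le> r} = {}" by (auto simp: not_le intro: less_le_trans[OF _ norm_ge_zero])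
  then show ?thesis by (simp add: set_integrable_def)
next
  case True
  define f where "f t = indicator {-r..r} t * \<bar>t\<bar> powr (- a / 3)" for t :: real
  have fm[measurable]: "f \<in> borel_measurable borel" unfolding f_def by measurable
  have "(\<lambda>x. x powr (- a/3)) integrable_on {0<..r}"
    using assms True by (intro integrable_on_powr_from_0') auto
  then have "(\<lambda>x. x powr (- a/3)) absolutely_integrable_on {0<..r}"
    by (rule nonnegative_absolutely_integrable_1) auto
  then have "integrable lborel (\<lambda>x. indicator {0<..r} x *\<^sub>R x powr (- a/3))"
    unfolding set_integrable_def by (rule integrable_completion[THEN iffD1, rotated]) measurable
  then have "set_integrable lborel {0<..} f"
    unfolding set_integrable_def
    by (rule Bochner_Integration.integrable_bound) (auto simp: f_def indicator_def)
  then have f: "integrable lborel f"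
    by (rule integrable_lborel_even) (auto simp: f_def indicator_def)
  have nn: "0 \<le> f t" for t by (simp add: f_def)
  have I: "integrable lborel (\<lambda>z::real^3. f (z$1) * f (z$2) * f (z$3))"
    using integrable_lborel_vec3_prod[OF f nn] .
  show ?thesis unfolding set_integrable_def
  proof (rule integrableI_bounded)
    show "(\<lambda>z::real^3. indicat_real {z. norm z \<le> r} z *\<^sub>R norm z powr - a) \<in> borel_measurable lborel"
      by measurable
    have "AE z in lborel. \<forall>i. (z::real^3)$i \<noteq> 0"
      using AE_lborel_component_notin_countable[of "{0}"] by simp
    then have "AE z in lborel. norm (indicat_real {z. norm z \<le> r} (z::real^3) *\<^sub>R norm z powr - a)
        \<le> norm (f (z$1) * f (z$2) * f (z$3))"
    proof eventually_elim
      case (elim z)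
      show ?case
      proof (cases "norm z \<le> r")
        case True
        have c: "\<bar>z$i\<bar> \<le> norm z" for i by (rule component_le_norm_cart)
        have pos: "0 < \<bar>z$i\<bar>" for i using elim by simp
        have le: "norm z powr (- a/3) \<le> f (z$i)" for i
        proof -
          have "norm z powr (- a/3) \<le> \<bar>z$i\<bar> powr (- a/3)"
            using c[of i] pos[of i] assms by (intro powr_mono2') auto
          moreover have "z$i \<in> {-r..r}" using c[of i] True by auto
          ultimately show ?thesis by (simp add: f_def)
        qed
        have "norm z powr (-a) = norm z powr (- a/3) * norm z powr (- a/3) * norm z powr (- a/3)"
          by (simp add: powr_add[symmetric])
        also have "\<dots> \<le> f (z$1) * f (z$2) * f (z$3)"
          by (intro mult_mono le) (auto simp: nn)
        finally show ?thesis using True by (simp add: nn)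
      qed simp
    qed
    then have "(\<integral>\<^sup>+z. norm (indicat_real {z. norm z \<le> r} (z::real^3) *\<^sub>R norm z powr - a) \<partial>lborel)
      \<le> (\<integral>\<^sup>+z. norm (f (z$1) * f (z$2) * f ((z::real^3)$3)) \<partial>lborel)"
      by (intro nn_integral_mono_AE) (auto elim!: eventually_mono)
    also have "\<dots> < \<infinity>" using I by (simp add: integrable_iff_bounded)
    finally show "(\<integral>\<^sup>+z. norm (indicat_real {z. norm z \<le> r} (z::real^3) *\<^sub>R norm z powr - a) \<partial>lborel) < \<infinity>" .
  qed
qed

text \<open>The same product comparison, now with a/3 > 1 for decay. Since |z| >= r, also max(r,
  |z_i|) <= |z|, and the maximum keeps each factor bounded near 0.\<close>

lemma integrable_norm_powr_at_infinity:
  fixes r a :: real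
  assumes a: "3 < a" and r: "0 < r"
  shows "set_integrable lborel {z::real^3. r \<le> norm z} (\<lambda>z. norm z powr (- a))"
proof -
  define f where "f t = (max r \<bar>t\<bar>) powr (- a / 3)" for t :: real
  have fm[measurable]: "f \<in> borel_measurable borel" unfolding f_def by measurable
  have "((\<lambda>x. x powr (-a/3)) has_integral -(r powr (-a/3+1)) / (-a/3+1)) {r..}"
    using assms by (intro has_integral_powr_to_inf) auto
  then have "(\<lambda>x. x powr (-a/3)) absolutely_integrable_on {r..}"
    by (intro nonnegative_absolutely_integrable_1) (auto simp: integrable_on_def)
  then have i1: "integrable lborel (\<lambda>x. indicator {r..} x *\<^sub>R x powr (- a/3))"
    unfolding set_integrable_def by (rule integrable_completion[THEN iffD1, rotated]) measurable
  have i2: "integrable lborel (\<lambda>x. indicator {0..r} x *\<^sub>R r powr (- a/3))"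
    by (rule borel_integrable_atLeastAtMost'[unfolded set_integrable_def]) auto
  have "set_integrable lborel {0<..} f"
    unfolding set_integrable_def
    by (rule Bochner_Integration.integrable_bound[OF Bochner_Integration.integrable_add[OF i1 i2]])
       (use r in \<open>auto simp: f_def indicator_def max_def\<close>)
  then have f: "integrable lborel f"
    by (rule integrable_lborel_even) (auto simp: f_def)
  have nn: "0 \<le> f t" for t by (simp add: f_def)
  have I: "integrable lborel (\<lambda>z::real^3. f (z$1) * f (z$2) * f (z$3))"
    using integrable_lborel_vec3_prod[OF f nn] .
  show ?thesis unfolding set_integrable_def
  proof (rule Bochner_Integration.integrable_bound[OF I])
    show "(\<lambda>z::real^3. indicat_real {z. r \<le> norm z} z *\<^sub>R norm z powr - a) \<in> borel_measurable lborel"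
      by measurable
    have "norm (indicat_real {z. r \<le> norm z} (z::real^3) *\<^sub>R norm z powr - a)
        \<le> norm (f (z$1) * f (z$2) * f (z$3))" for z
    proof (cases "r \<le> norm z")
      case True
      have le: "norm z powr (- a/3) \<le> f (z$i)" for i
        unfolding f_def using True r a component_le_norm_cart[of z i]
        by (intro powr_mono2') auto
      have "norm z powr (-a) = norm z powr (- a/3) * norm z powr (- a/3) * norm z powr (- a/3)"
        by (simp add: powr_add[symmetric])
      also have "\<dots> \<le> f (z$1) * f (z$2) * f (z$3)"
        by (intro mult_mono le) (auto simp: nn)
      finally show ?thesis using True by (simp add: nn)
    qed simp
    then show "AE z in lborel. norm (indicat_real {z. r \<le> norm z} (z::real^3) *\<^sub>R norm z powr - a)
        \<le> norm (f (z$1) * f (z$2) * f (z$3))" by simp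
  qed
qed

section \<open>Orthogonal maps preserve Lebesgue measure: needed for reflections and for the cyclic
  permutation of coordinates\<close>

lemma lborel_distr_orthogonal:
  fixes f :: "real^3 \<Rightarrow> real^3"
  assumes f: "orthogonal_transformation f"
  shows "distr lborel borel f = lborel"
proof (rule lborel_eqI[symmetric])
  have lin: "linear f" using f by (rule orthogonal_transformation_linear)
  have bij: "bij f" using f by (rule orthogonal_transformation_bij)
  have g: "orthogonal_transformation (inv f)" using f by (rule orthogonal_transformation_inv)
  have fm[measurable]: "f \<in> borel_measurable borel"
    by (intro borel_measurable_continuous_onI linear_continuous_on linear_conv_bounded_linear[THEN iffD1] lin)
  fix l u :: "real^3" assume lu: "\<And>b. b \<in> Basis \<Longrightarrow> l \<bullet> b \<le> u \<bullet> b"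
  have "emeasure (distr lborel borel f) (box l u) = emeasure lborel (f -` box l u)"
    by (subst emeasure_distr) auto
  also have "f -` box l u = inv f ` box l u"
    using bij by (simp add: bij_vimage_eq_inv_image)
  also have "emeasure lborel (inv f ` box l u) = emeasure lebesgue (inv f ` box l u)"
  proof -
    have "f -` box l u \<in> sets borel" using measurable_sets[OF fm, of "box l u"] by simp
    then show ?thesis using bij by (simp add: bij_vimage_eq_inv_image)
  qed
  also have "\<dots> = ennreal (measure lebesgue (inv f ` box l u))"
  proof (rule emeasure_eq_measure2)
    show "inv f ` box l u \<in> lmeasurable"
      using g by (intro measurable_orthogonal_image) auto
  qed
  also have "measure lebesgue (inv f ` box l u) = measure lebesgue (box l u)"
    using g by (intro measure_orthogonal_image) auto
  also have "ennreal (measure lebesgue (box l u)) = ennreal (\<Prod>b\<in>Basis. (u - l) \<bullet> b)"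
    using lu by (simp add: inner_diff_left)
  finally show "emeasure (distr lborel borel f) (box l u) = (\<Prod>b\<in>Basis. (u - l) \<bullet> b)" .
qed auto

lemma integral_lborel_orthogonal:
  fixes f :: "real^3 \<Rightarrow> real^3" and g :: "real^3 \<Rightarrow> real"
  assumes f: "orthogonal_transformation f" and [measurable]: "g \<in> borel_measurable borel"
  shows "(\<integral>z. g (f z) \<partial>lborel) = (\<integral>z. g z \<partial>lborel)"
proof -
  have [measurable]: "f \<in> borel_measurable borel"
    using orthogonal_transformation_linear[OF f]
    by (intro borel_measurable_continuous_onI linear_continuous_on linear_conv_bounded_linear[THEN iffD1])
  have "(\<integral>z. g z \<partial>distr lborel borel f) = (\<integral>z. g (f z) \<partial>lborel)"
    by (subst integral_distr) auto
  then show ?thesis by (simp add: lborel_distr_orthogonal[OF f])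
qed

lemma integrable_lborel_orthogonal:
  fixes f :: "real^3 \<Rightarrow> real^3" and g :: "real^3 \<Rightarrow> real"
  assumes f: "orthogonal_transformation f" and g: "integrable lborel g"
  shows "integrable lborel (\<lambda>z. g (f z))"
proof -
  have [measurable]: "f \<in> borel_measurable borel" "g \<in> borel_measurable borel"
    using orthogonal_transformation_linear[OF f] g
    by (auto intro!: borel_measurable_continuous_onI linear_continuous_on linear_conv_bounded_linear[THEN iffD1])
  have "integrable (distr lborel borel f) g" using g by (simp add: lborel_distr_orthogonal[OF f])
  then show ?thesis by (subst (asm) integrable_distr_eq) auto
qed

section \<open>Taylor estimates from partial derivatives\<close>

text \<open>Matches the derivatives along coordinate lines that \<open>holder_C\<close> supplies
  through \<open>pd\<close>, so the Taylor estimates below can be read off from one-variable mean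
  value bounds.\<close>

definition has_partials :: "(real^3 \<Rightarrow> real) \<Rightarrow> (3 \<Rightarrow> real^3 \<Rightarrow> real) \<Rightarrow> bool" where
  "has_partials f F \<longleftrightarrow>
     (\<forall>x i. ((\<lambda>t. f (x + t *\<^sub>R axis i 1)) has_real_derivative F i x) (at 0))"

lemma has_partials_DERIV:
  assumes "has_partials f F"
  shows "((\<lambda>t. f (x + t *\<^sub>R axis i 1)) has_real_derivative F i (x + t *\<^sub>R axis i 1)) (at t)"
proof -
  have "((\<lambda>h. f ((x + t *\<^sub>R axis i 1) + h *\<^sub>R axis i 1)) has_real_derivative F i (x + t *\<^sub>R axis i 1)) (at 0)"
    using assms by (simp add: has_partials_def)
  then have "((\<lambda>h. f (x + (t + h) *\<^sub>R axis i 1)) has_real_derivative F i (x + t *\<^sub>R axis i 1)) (at 0)"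
    by (simp add: algebra_simps)
  then show ?thesis
    using DERIV_at_within_shift[of "\<lambda>h. f (x + h *\<^sub>R axis i 1)" "F i (x + t *\<^sub>R axis i 1)" t 0 UNIV]
    by simp
qed

lemma has_partials_pd:
  assumes "f \<in> holder_C k s" "length is < k"
  shows "has_partials (pd is f) (\<lambda>i. pd (i # is) f)"
  using assms unfolding has_partials_def holder_C_def
  by (auto simp: DERIV_deriv_iff_field_differentiable)

lemma has_partials_diff_axis_bound:
  assumes f: "has_partials f F"
    and B: "\<And>\<tau>. \<bar>\<tau>\<bar> \<le> \<bar>t\<bar> \<Longrightarrow> \<bar>F i (x + \<tau> *\<^sub>R axis i 1)\<bar> \<le> B"
  shows "\<bar>f (x + t *\<^sub>R axis i 1) - f x\<bar> \<le> B * \<bar>t\<bar>"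
proof -
  have "norm (f (x + t *\<^sub>R axis i 1) - f (x + 0 *\<^sub>R axis i 1)) \<le> B * norm (t - 0)"
    by (rule field_differentiable_bound[where S = "closed_segment 0 t" and f'="\<lambda>\<tau>. F i (x + \<tau> *\<^sub>R axis i 1)"])
      (auto intro!: has_partials_DERIV[OF f] has_field_derivative_at_within B
            simp: closed_segment_eq_real_ivl split: if_splits)
  then show ?thesis by simp
qed

text \<open>From x to x + z in three steps parallel to the axes. Each intermediate displacement is
  componentwise at most z, so it stays in the ball of radius |z|; the 3 counts the steps.\<close>

lemma has_partials_diff_bound:
  assumes f: "has_partials f F"
    and B: "\<And>i w. norm w \<le> norm z \<Longrightarrow> \<bar>F i (x + w)\<bar> \<le> B"
  shows "\<bar>f (x + z) - f x\<bar> \<le> 3 * B * norm z"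
proof -
  define z1 :: "real^3" where "z1 = z$1 *\<^sub>R axis 1 1"
  define z2 :: "real^3" where "z2 = z1 + z$2 *\<^sub>R axis 2 1"
  have z: "z = z2 + z$3 *\<^sub>R axis 3 1"
    by (simp add: z1_def z2_def vec_eq_iff forall_3 axis_def)
  have B0: "0 \<le> B" using B[of 0 1] by (smt (verit) norm_ge_zero norm_zero)
  have step: "\<bar>f ((x + w) + z$i *\<^sub>R axis i 1) - f (x + w)\<bar> \<le> B * norm z"
    if w: "\<And>\<tau> j. \<bar>\<tau>\<bar> \<le> \<bar>z$i\<bar> \<Longrightarrow> \<bar>(w + \<tau> *\<^sub>R axis i 1)$j\<bar> \<le> \<bar>z$j\<bar>" for w i
  proof -
    have "\<bar>f ((x + w) + z$i *\<^sub>R axis i 1) - f (x + w)\<bar> \<le> B * \<bar>z$i\<bar>"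
    proof (rule has_partials_diff_axis_bound[OF f])
      fix \<tau> :: real assume "\<bar>\<tau>\<bar> \<le> \<bar>z$i\<bar>"
      then have "norm (w + \<tau> *\<^sub>R axis i 1) \<le> norm z"
        using w by (intro norm_le_componentwise_cart) simp
      then show "\<bar>F i (x + w + \<tau> *\<^sub>R axis i 1)\<bar> \<le> B"
        using B[of "w + \<tau> *\<^sub>R axis i 1" i] by (simp add: add.assoc)
    qed
    also have "\<dots> \<le> B * norm z"
      using B0 component_le_norm_cart[of z i] by (intro mult_left_mono) auto
    finally show ?thesis .
  qed
  have "\<bar>f (x + z1) - f x\<bar> \<le> B * norm z"
    using step[where w=0 and i=1] unfolding z1_def by (simp add: axis_def)
  moreover have "\<bar>f (x + z2) - f (x + z1)\<bar> \<le> B * norm z"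
    using step[where w=z1 and i=2] unfolding z2_def z1_def
    by (simp add: axis_def add.assoc)
  moreover have "\<bar>f (x + z) - f (x + z2)\<bar> \<le> B * norm z"
    using step[where w=z2 and i=3] unfolding z2_def z1_def
    by (subst z, simp add: axis_def add.assoc z1_def z2_def)
  ultimately show ?thesis by linarith
qed

lemma has_partials_linear: "has_partials (\<lambda>x. \<Sum>i\<in>UNIV. a i * x$i) (\<lambda>i x. a i)"
  unfolding has_partials_def
proof (intro allI)
  fix x :: "real^3" and i :: 3
  show "((\<lambda>t. \<Sum>j\<in>UNIV. a j * (x + t *\<^sub>R axis i 1)$j) has_real_derivative a i) (at 0)"
    unfolding sum_3 using exhaust_3[of i]
    by (elim disjE) (auto intro!: derivative_eq_intros simp: axis_def)
qed

lemma has_partials_diff: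
  assumes "has_partials f F" "has_partials g G"
  shows "has_partials (\<lambda>x. f x - g x) (\<lambda>i x. F i x - G i x)"
  using assms unfolding has_partials_def by (auto intro!: derivative_intros)

text \<open>The difference bound, applied to f minus its linear part at x, whose partials are the
  increments of F.\<close>

lemma has_partials_taylor1:
  assumes f: "has_partials f F"
    and B: "\<And>i w. norm w \<le> norm z \<Longrightarrow> \<bar>F i (x + w) - F i x\<bar> \<le> B"
  shows "\<bar>f (x + z) - f x - (\<Sum>i\<in>UNIV. F i x * z$i)\<bar> \<le> 3 * B * norm z"
proof -
  have "has_partials (\<lambda>y. f y - (\<Sum>i\<in>UNIV. F i x * y$i)) (\<lambda>i y. F i y - F i x)"
    by (intro has_partials_diff f has_partials_linear)
  from has_partials_diff_bound[OF this B, of z]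
  show ?thesis by (simp add: algebra_simps sum.distrib)
qed

lemma has_partials_taylor2:
  assumes f: "has_partials f F" and F: "\<And>i. has_partials (F i) (H i)"
    and B: "\<And>i j w. norm w \<le> norm z \<Longrightarrow> \<bar>H i j (x + w)\<bar> \<le> B"
  shows "\<bar>f (x + z) - f x - (\<Sum>i\<in>UNIV. F i x * z$i)\<bar> \<le> 9 * B * (norm z)^2"
proof -
  have B0: "0 \<le> B" using B[of 0 1 1] by (smt (verit) norm_ge_zero norm_zero)
  have "\<bar>f (x + z) - f x - (\<Sum>i\<in>UNIV. F i x * z$i)\<bar> \<le> 3 * (3 * B * norm z) * norm z"
  proof (rule has_partials_taylor1[OF f])
    fix i and w :: "real^3" assume w: "norm w \<le> norm z"
    have "\<bar>F i (x + w) - F i x\<bar> \<le> 3 * B * norm w"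
      by (rule has_partials_diff_bound[OF F]) (use B w in force)
    also have "\<dots> \<le> 3 * B * norm z" using w B0 by (intro mult_left_mono) auto
    finally show "\<bar>F i (x + w) - F i x\<bar> \<le> 3 * B * norm z" .
  qed
  then show ?thesis by (simp add: power2_eq_square mult.assoc)
qed

text \<open>Reflections act as \<open>\<sigma> * \<xi>\<close>, the componentwise product of vectors.\<close>

definition signs :: "(real^3) set" where
  "signs = {\<sigma>. \<forall>i. \<sigma>$i = 1 \<or> \<sigma>$i = -1}"

lemma sum_signs:
  "(\<Sum>\<sigma>\<in>signs. f \<sigma>) = (\<Sum>a\<in>{1,-1}. \<Sum>b\<in>{1,-1}. \<Sum>c\<in>{1,-1}. f (pt3 a b c))"
proof -
  have "bij_betw (\<lambda>(a,b,c). pt3 a b c) ({1,-1} \<times> {1,-1} \<times> {1,-1}) signs"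
    by (rule bij_betw_byWitness[where f' = "\<lambda>\<sigma>. (\<sigma>$1, \<sigma>$2, \<sigma>$3)"])
       (auto simp: signs_def pt3_def vec_eq_iff forall_3)
  from sum.reindex_bij_betw[OF this, of f, symmetric] show ?thesis
    by (simp add: sum.cartesian_product split_def add.assoc)
qed

lemma finite_signs [simp]: "finite signs"
proof -
  have "signs \<subseteq> (\<lambda>(a,b,c). pt3 a b c) ` ({1,-1} \<times> {1,-1} \<times> {1,-1})"
  proof
    fix \<sigma> assume "\<sigma> \<in> signs"
    then show "\<sigma> \<in> (\<lambda>(a,b,c). pt3 a b c) ` ({1,-1} \<times> {1,-1} \<times> {1,-1})"
      by (intro image_eqI[of _ _ "(\<sigma>$1, \<sigma>$2, \<sigma>$3)"])
         (auto simp: signs_def pt3_def vec_eq_iff forall_3)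
  qed
  then show ?thesis by (rule finite_subset) simp
qed

lemma card_signs: "real (card signs) = 8"
  using sum_signs[of "\<lambda>_. 1::real"] by simp

lemma sum_signs_component: "(\<Sum>\<sigma>\<in>signs. \<sigma>$i) = 0"
  unfolding sum_signs using exhaust_3[of i] by (elim disjE) (simp_all add: pt3_def)

text \<open>Orthogonality of the sign characters: in a second-order expansion summed over all
  reflections the mixed terms drop out and each pure term is counted eight times.\<close>

lemma sum_signs_component2: "(\<Sum>\<sigma>\<in>signs. \<sigma>$i * \<sigma>$j) = (if i = j then 8 else 0)"
  unfolding sum_signs using exhaust_3[of i] exhaust_3[of j]
  by (elim disjE) (simp_all add: pt3_def)

lemma abs_signs: "\<sigma> \<in> signs \<Longrightarrow> \<bar>\<sigma>$i\<bar> = 1"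
  unfolding signs_def by (metis (mono_tags) abs_1 abs_minus_cancel mem_Collect_eq)

lemma signs_uminus: "bij_betw uminus signs signs"
  by (rule bij_betw_byWitness[where f' = uminus]) (force simp: signs_def)+

lemma norm_signs_mult: "\<sigma> \<in> signs \<Longrightarrow> norm (\<sigma> * z) = norm (z::real^3)"
  unfolding norm_vec_def by (simp add: abs_mult abs_signs)

text \<open>Differentiating in direction i brings down the factor \<sigma>_i. The weights
  \<open>w\<close> allow iteration: constant 1 for u, then \<open>\<sigma>$i\<close> for its first
  partials.\<close>

lemma has_partials_signs_sum:
  assumes "has_partials v V"
  shows "has_partials (\<lambda>\<xi>. \<Sum>\<sigma>\<in>signs. w \<sigma> * v (x + \<sigma> * \<xi>)) (\<lambda>i \<xi>. \<Sum>\<sigma>\<in>signs. w \<sigma> * \<sigma>$i * V i (x + \<sigma> * \<xi>))"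
  unfolding has_partials_def
proof (intro allI)
  fix \<xi> :: "real^3" and i :: 3
  have "((\<lambda>t. v (x + \<sigma> * (\<xi> + t *\<^sub>R axis i 1))) has_real_derivative \<sigma>$i * V i (x + \<sigma> * \<xi>)) (at 0)" for \<sigma>
  proof -
    have "x + \<sigma> * (\<xi> + t *\<^sub>R axis i 1) = (x + \<sigma> * \<xi>) + (\<sigma>$i * t) *\<^sub>R axis i 1" for t
      by (simp add: vec_eq_iff axis_def algebra_simps)
    moreover have "((\<lambda>t. v ((x + \<sigma> * \<xi>) + (\<sigma>$i * t) *\<^sub>R axis i 1)) has_real_derivative
        V i ((x + \<sigma> * \<xi>) + (\<sigma>$i * 0) *\<^sub>R axis i 1) * \<sigma>$i) (at 0)"
      by (rule DERIV_chain2[OF has_partials_DERIV[OF assms]]) (auto intro!: derivative_eq_intros)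
    ultimately show ?thesis by (simp add: mult.commute[of _ "\<sigma>$i"] add.assoc)
  qed
  then show "((\<lambda>t. \<Sum>\<sigma>\<in>signs. w \<sigma> * v (x + \<sigma> * (\<xi> + t *\<^sub>R axis i 1))) has_real_derivative
      (\<Sum>\<sigma>\<in>signs. w \<sigma> * \<sigma>$i * V i (x + \<sigma> * \<xi>))) (at 0)"
    unfolding mult.assoc by (intro DERIV_sum DERIV_cmult)
qed

text \<open>There are finitely many index lists of length k, so the sum of the absolute values of
  their Hoelder constants serves all of them.\<close>

lemma holder_C_uniform_const:
  assumes "f \<in> holder_C k s"
  obtains K where "K \<ge> 0" "\<And>is x y. length is = k \<Longrightarrow> \<bar>pd is f x - pd is f y\<bar> \<le> K * dist x y powr s"
proof -
  obtain K where K: "\<And>is x y. length is = k \<Longrightarrow> \<bar>pd is f x - pd is f y\<bar> \<le> K is * dist x y powr s"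
    using assms unfolding holder_C_def by (auto intro: that) metis
  let ?I = "{is::3 list. length is = k}"
  have fin: "finite ?I" using finite_lists_length_eq[of "UNIV::3 set" k] by simp
  show thesis
  proof (rule that[of "\<Sum>is\<in>?I. \<bar>K is\<bar>"])
    fix "is" :: "3 list" and x y assume l: "length is = k"
    have "K is \<le> (\<Sum>is\<in>?I. \<bar>K is\<bar>)"
      using member_le_sum[of "is" ?I "\<lambda>is. \<bar>K is\<bar>"] l fin by auto
    then show "\<bar>pd is f x - pd is f y\<bar> \<le> (\<Sum>is\<in>?I. \<bar>K is\<bar>) * dist x y powr s"
      using K[OF l, of x y] by (meson mult_right_mono order_trans powr_ge_zero)
  qed (simp add: sum_nonneg)
qed

text \<open>For \<open>\<alpha> \<ge> 1\<close> the Hoelder condition is on third derivatives; the first-order terms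
  of \<open>\<sigma>\<close> and \<open>-\<sigma>\<close> then cancel, which raises the order by one.\<close>

lemma signs_second_partials_bound:
  assumes \<alpha>: "0 < \<alpha>" "\<alpha> < 2" and "0 < \<epsilon>"
    and u: "u \<in> holder_C (2 + nat \<lfloor>\<alpha>\<rfloor>) (\<alpha> - of_int \<lfloor>\<alpha>\<rfloor> + \<epsilon>)"
  obtains K where "K \<ge> 0"
    "\<And>x i j \<xi>. \<bar>\<Sum>\<sigma>\<in>signs. \<sigma>$i * \<sigma>$j * (pd [j,i] u (x + \<sigma> * \<xi>) - pd [j,i] u x)\<bar> \<le> K * norm \<xi> powr (\<alpha> + \<epsilon>)"
proof (cases "\<alpha> < 1")
  case True
  then have fl: "\<lfloor>\<alpha>\<rfloor> = 0" using \<alpha> by linarith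
  obtain K where K0: "K \<ge> 0" and K: "\<And>is x y. length is = 2 \<Longrightarrow> \<bar>pd is u x - pd is u y\<bar> \<le> K * dist x y powr (\<alpha> + \<epsilon>)"
    using holder_C_uniform_const[OF u] fl by auto
  show thesis
  proof (rule that[of "8 * K"])
    fix x i j \<xi>
    have "\<bar>\<Sum>\<sigma>\<in>signs. \<sigma>$i * \<sigma>$j * (pd [j,i] u (x + \<sigma> * \<xi>) - pd [j,i] u x)\<bar> \<le> (\<Sum>\<sigma>\<in>signs. K * norm \<xi> powr (\<alpha> + \<epsilon>))"
    proof (rule order_trans[OF sum_abs sum_mono])
      fix \<sigma> assume s: "\<sigma> \<in> signs"
      show "\<bar>\<sigma>$i * \<sigma>$j * (pd [j,i] u (x + \<sigma> * \<xi>) - pd [j,i] u x)\<bar> \<le> K * norm \<xi> powr (\<alpha> + \<epsilon>)"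
        using K[of "[j,i]" "x + \<sigma> * \<xi>" x] by (simp add: abs_mult abs_signs[OF s] dist_norm norm_signs_mult[OF s])
    qed
    then show "\<bar>\<Sum>\<sigma>\<in>signs. \<sigma>$i * \<sigma>$j * (pd [j,i] u (x + \<sigma> * \<xi>) - pd [j,i] u x)\<bar> \<le> 8 * K * norm \<xi> powr (\<alpha> + \<epsilon>)"
      by (simp add: card_signs)
  qed (use K0 in simp)
next
  case False
  then have fl: "\<lfloor>\<alpha>\<rfloor> = 1" using \<alpha> by linarith
  obtain K where K0: "K \<ge> 0" and K: "\<And>is x y. length is = 3 \<Longrightarrow> \<bar>pd is u x - pd is u y\<bar> \<le> K * dist x y powr (\<alpha> - 1 + \<epsilon>)"
    using holder_C_uniform_const[OF u] fl by auto
  have u3: "u \<in> holder_C 3 (\<alpha> - 1 + \<epsilon>)" using u fl by simp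
  show thesis
  proof (rule that[of "24 * K"])
    fix x i j \<xi>
    define v where "v = pd [j,i] u"
    define V where "V l = pd [l,j,i] u" for l
    have v: "has_partials v V"
      unfolding v_def V_def by (rule has_partials_pd[OF u3]) simp
    have t: "\<bar>v (x + \<sigma> * \<xi>) - v x - (\<Sum>l\<in>UNIV. V l x * (\<sigma> * \<xi>)$l)\<bar> \<le> 3 * K * norm \<xi> powr (\<alpha> + \<epsilon>)"
      if s: "\<sigma> \<in> signs" for \<sigma>
    proof -
      have "\<bar>v (x + \<sigma> * \<xi>) - v x - (\<Sum>l\<in>UNIV. V l x * (\<sigma> * \<xi>)$l)\<bar> \<le> 3 * (K * norm \<xi> powr (\<alpha> - 1 + \<epsilon>)) * norm (\<sigma> * \<xi>)"
      proof (rule has_partials_taylor1[OF v])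
        fix l and w :: "real^3" assume w: "norm w \<le> norm (\<sigma> * \<xi>)"
        have "\<bar>V l (x + w) - V l x\<bar> \<le> K * norm w powr (\<alpha> - 1 + \<epsilon>)"
          using K[of "[l,j,i]" "x + w" x] by (simp add: V_def dist_norm)
        also have "\<dots> \<le> K * norm \<xi> powr (\<alpha> - 1 + \<epsilon>)"
          using w s K0 False \<open>0 < \<epsilon>\<close> by (intro mult_left_mono powr_mono2) (auto simp: norm_signs_mult)
        finally show "\<bar>V l (x + w) - V l x\<bar> \<le> K * norm \<xi> powr (\<alpha> - 1 + \<epsilon>)" .
      qed
      also have "\<dots> = 3 * K * norm \<xi> powr (\<alpha> + \<epsilon>)"
        using powr_add[of "norm \<xi>" "\<alpha> - 1 + \<epsilon>" 1] by (simp add: norm_signs_mult[OF s] algebra_simps)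
      finally show ?thesis .
    qed
    have odd: "(\<Sum>\<sigma>\<in>signs. \<sigma>$i * \<sigma>$j * (\<Sum>l\<in>UNIV. V l x * (\<sigma> * \<xi>)$l)) = 0" (is "?O = 0")
    proof -
      have "?O = (\<Sum>\<sigma>\<in>signs. (-\<sigma>)$i * (-\<sigma>)$j * (\<Sum>l\<in>UNIV. V l x * ((-\<sigma>) * \<xi>)$l))"
        by (rule sum.reindex_bij_betw[OF signs_uminus, symmetric])
      also have "\<dots> = - ?O" by (simp add: sum_negf)
      finally show ?thesis by simp
    qed
    have "\<bar>\<Sum>\<sigma>\<in>signs. \<sigma>$i * \<sigma>$j * (v (x + \<sigma> * \<xi>) - v x)\<bar>
      = \<bar>\<Sum>\<sigma>\<in>signs. \<sigma>$i * \<sigma>$j * (v (x + \<sigma> * \<xi>) - v x - (\<Sum>l\<in>UNIV. V l x * (\<sigma> * \<xi>)$l))\<bar>"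
      using odd by (simp only: right_diff_distrib sum_subtractf diff_zero)
    also have "\<dots> \<le> (\<Sum>\<sigma>\<in>signs. 3 * K * norm \<xi> powr (\<alpha> + \<epsilon>))"
    proof (rule order_trans[OF sum_abs sum_mono])
      fix \<sigma> assume s: "\<sigma> \<in> signs"
      show "\<bar>\<sigma>$i * \<sigma>$j * (v (x + \<sigma> * \<xi>) - v x - (\<Sum>l\<in>UNIV. V l x * (\<sigma> * \<xi>)$l))\<bar> \<le> 3 * K * norm \<xi> powr (\<alpha> + \<epsilon>)"
        using t[OF s] by (simp add: abs_mult abs_signs[OF s])
    qed
    finally show "\<bar>\<Sum>\<sigma>\<in>signs. \<sigma>$i * \<sigma>$j * (pd [j,i] u (x + \<sigma> * \<xi>) - pd [j,i] u x)\<bar> \<le> 24 * K * norm \<xi> powr (\<alpha> + \<epsilon>)"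
      by (simp add: card_signs v_def)
  qed (use K0 in simp)
qed

section \<open>The symmetrized difference and its Taylor remainder at 0\<close>

definition sym_diff8 :: "(real^3 \<Rightarrow> real) \<Rightarrow> real^3 \<Rightarrow> real^3 \<Rightarrow> real" where
  "sym_diff8 u x \<xi> = (\<Sum>\<sigma>\<in>signs. u (x + \<sigma> * \<xi>)) - 8 * u x"

text \<open>The 4 is the Taylor factor 1/2 times the second moment 8 of the sign vectors.\<close>

definition sym_rem :: "(real^3 \<Rightarrow> real) \<Rightarrow> real^3 \<Rightarrow> real^3 \<Rightarrow> real" where
  "sym_rem u x \<xi> = sym_diff8 u x \<xi> - 4 * (\<Sum>i\<in>UNIV. pd [i,i] u x * (\<xi>$i)^2)"

definition sym_rem_d :: "(real^3 \<Rightarrow> real) \<Rightarrow> real^3 \<Rightarrow> 3 \<Rightarrow> real^3 \<Rightarrow> real" where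
  "sym_rem_d u x i \<xi> = (\<Sum>\<sigma>\<in>signs. \<sigma>$i * pd [i] u (x + \<sigma> * \<xi>)) - 8 * pd [i,i] u x * \<xi>$i"

text \<open>The second partials of the remainder in \<xi> are exactly the sums bounded in
  \<open>signs_second_partials_bound\<close>. Integrating twice from 0, where the remainder and its
  gradient vanish, gives the first two bounds; a Taylor expansion at c gives the third. The constant
  is chosen before x.\<close>

lemma sym_rem_estimates:
  assumes \<alpha>: "0 < \<alpha>" "\<alpha> < 2" and e: "0 < \<epsilon>"
    and u: "u \<in> holder_C (2 + nat \<lfloor>\<alpha>\<rfloor>) (\<alpha> - of_int \<lfloor>\<alpha>\<rfloor> + \<epsilon>)"
  obtains K where "K \<ge> 0"
    "\<And>x \<xi>. \<bar>sym_rem u x \<xi>\<bar> \<le> K * norm \<xi> powr (\<alpha> + \<epsilon>) * norm \<xi>^2"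
    "\<And>x i \<xi>. \<bar>sym_rem_d u x i \<xi>\<bar> \<le> K * norm \<xi> powr (\<alpha> + \<epsilon>) * norm \<xi>"
    "\<And>x c z. \<bar>sym_rem u x (c + z) - sym_rem u x c - (\<Sum>i\<in>UNIV. sym_rem_d u x i c * z$i)\<bar>
        \<le> K * (norm c + norm z) powr (\<alpha> + \<epsilon>) * norm z^2"
proof -
  let ?s = "\<alpha> + \<epsilon>"
  obtain K where K0: "K \<ge> 0" and K:
    "\<And>x i j \<xi>. \<bar>\<Sum>\<sigma>\<in>signs. \<sigma>$i * \<sigma>$j * (pd [j,i] u (x + \<sigma> * \<xi>) - pd [j,i] u x)\<bar> \<le> K * norm \<xi> powr ?s"
    using signs_second_partials_bound[OF \<alpha> e u] by blast
  \<comment> \<open>The second partials of the remainder. Subtracting 8 times the pure derivative at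
    x amounts to subtracting \<open>pd [j,i] u x\<close> inside the sum, because the sum of
    \<sigma>_i \<sigma>_j is 8 or 0.\<close>
  define H where "H x i j \<xi> = (\<Sum>\<sigma>\<in>signs. \<sigma>$i * \<sigma>$j * pd [j,i] u (x + \<sigma> * \<xi>)) - (if i = j then 8 * pd [i,i] u x else 0)" for x i j \<xi>
  have Hb: "\<bar>H x i j \<xi>\<bar> \<le> K * norm \<xi> powr ?s" for x i j \<xi>
  proof -
    have "H x i j \<xi> = (\<Sum>\<sigma>\<in>signs. \<sigma>$i * \<sigma>$j * (pd [j,i] u (x + \<sigma> * \<xi>) - pd [j,i] u x))"
      unfolding H_def right_diff_distrib sum_subtractf sum_distrib_right[symmetric] sum_signs_component2 by auto
    then show ?thesis using K by simp
  qed
  have Rd: "has_partials (sym_rem u x) (sym_rem_d u x)" for x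
  proof -
    have "has_partials u (\<lambda>i. pd [i] u)" using has_partials_pd[OF u, of "[]"] by simp
    from has_partials_signs_sum[OF this, of "\<lambda>_. 1" x]
    have 1: "has_partials (\<lambda>\<xi>. \<Sum>\<sigma>\<in>signs. u (x + \<sigma> * \<xi>)) (\<lambda>i \<xi>. \<Sum>\<sigma>\<in>signs. \<sigma>$i * pd [i] u (x + \<sigma> * \<xi>))"
      by simp
    have 2: "has_partials (\<lambda>\<xi>. 8 * u x + 4 * (\<Sum>i\<in>UNIV. pd [i,i] u x * (\<xi>$i)^2)) (\<lambda>i \<xi>. 8 * pd [i,i] u x * \<xi>$i)"
      unfolding has_partials_def
    proof (intro allI)
      fix y :: "real^3" and i :: 3
      show "((\<lambda>t. 8 * u x + 4 * (\<Sum>j\<in>UNIV. pd [j,j] u x * ((y + t *\<^sub>R axis i 1)$j)^2)) has_real_derivative 8 * pd [i,i] u x * y$i) (at 0)"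
        unfolding sum_3 using exhaust_3[of i]
        by (elim disjE) (auto intro!: derivative_eq_intros simp: axis_def simp del: pd.simps)
    qed
    have "sym_rem u x = (\<lambda>\<xi>. (\<Sum>\<sigma>\<in>signs. u (x + \<sigma> * \<xi>)) - (8 * u x + 4 * (\<Sum>i\<in>UNIV. pd [i,i] u x * (\<xi>$i)^2)))"
      by (auto simp: sym_rem_def sym_diff8_def fun_eq_iff)
    moreover have "sym_rem_d u x = (\<lambda>i \<xi>. (\<Sum>\<sigma>\<in>signs. \<sigma>$i * pd [i] u (x + \<sigma> * \<xi>)) - 8 * pd [i,i] u x * \<xi>$i)"
      by (auto simp: sym_rem_d_def fun_eq_iff)
    ultimately show ?thesis using has_partials_diff[OF 1 2] by simp
  qed
  have Rdd: "has_partials (sym_rem_d u x i) (H x i)" for x i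
  proof -
    have "has_partials (pd [i] u) (\<lambda>j. pd [j,i] u)" by (rule has_partials_pd[OF u]) simp
    from has_partials_signs_sum[OF this, of "\<lambda>\<sigma>. \<sigma>$i" x]
    have 1: "has_partials (\<lambda>\<xi>. \<Sum>\<sigma>\<in>signs. \<sigma>$i * pd [i] u (x + \<sigma> * \<xi>)) (\<lambda>j \<xi>. \<Sum>\<sigma>\<in>signs. \<sigma>$i * \<sigma>$j * pd [j,i] u (x + \<sigma> * \<xi>))" .
    have 2: "has_partials (\<lambda>\<xi>. \<Sum>j\<in>UNIV. (if i = j then 8 * pd [i,i] u x else 0) * \<xi>$j) (\<lambda>j \<xi>. (if i = j then 8 * pd [i,i] u x else 0))"
      by (rule has_partials_linear)
    have "(\<Sum>j\<in>UNIV. (if i = j then 8 * pd [i,i] u x else 0) * \<xi>$j) = 8 * pd [i,i] u x * \<xi>$i" for \<xi>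
      by (simp add: if_distrib[where f="\<lambda>a. a * _"] cong: if_cong del: pd.simps)
    then have "sym_rem_d u x i = (\<lambda>\<xi>. (\<Sum>\<sigma>\<in>signs. \<sigma>$i * pd [i] u (x + \<sigma> * \<xi>)) - (\<Sum>j\<in>UNIV. (if i = j then 8 * pd [i,i] u x else 0) * \<xi>$j))"
      by (auto simp: sym_rem_d_def fun_eq_iff)
    moreover have "H x i = (\<lambda>j \<xi>. (\<Sum>\<sigma>\<in>signs. \<sigma>$i * \<sigma>$j * pd [j,i] u (x + \<sigma> * \<xi>)) - (if i = j then 8 * pd [i,i] u x else 0))"
      by (auto simp: H_def fun_eq_iff)
    ultimately show ?thesis using has_partials_diff[OF 1 2] by simp
  qed
  have z1: "\<sigma> * 0 = 0" for \<sigma> :: "real^3" by (simp add: vec_eq_iff)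
  have R0: "sym_rem u x 0 = 0" for x
    by (simp add: sym_rem_def sym_diff8_def z1 card_signs)
  have F0: "sym_rem_d u x i 0 = 0" for x i
    by (simp add: sym_rem_d_def z1 sum_distrib_right[symmetric] sum_signs_component)
  have Hb': "\<bar>H x i j w\<bar> \<le> K * r powr ?s" if "norm w \<le> r" for x i j w r
    using that \<alpha> e K0 by (intro order_trans[OF Hb] mult_left_mono powr_mono2) auto
  have b1: "\<bar>sym_rem_d u x i \<xi>\<bar> \<le> 3 * (K * norm \<xi> powr ?s) * norm \<xi>" for x i \<xi>
    using has_partials_diff_bound[OF Rdd[of x i], of \<xi> 0 "K * norm \<xi> powr ?s"] Hb' F0 by simp
  have b0: "\<bar>sym_rem u x \<xi>\<bar> \<le> 9 * (K * norm \<xi> powr ?s) * norm \<xi>^2" for x \<xi>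
    using has_partials_taylor2[OF Rd[of x] Rdd[of x], of \<xi> 0 "K * norm \<xi> powr ?s"] Hb' F0 R0 by simp
  have b2: "\<bar>sym_rem u x (c + z) - sym_rem u x c - (\<Sum>i\<in>UNIV. sym_rem_d u x i c * z$i)\<bar>
        \<le> 9 * (K * (norm c + norm z) powr ?s) * norm z^2" for x c z
  proof (rule has_partials_taylor2[OF Rd Rdd])
    fix i j and w :: "real^3" assume "norm w \<le> norm z"
    then have "norm (c + w) \<le> norm c + norm z" using norm_triangle_ineq[of c w] by linarith
    then show "\<bar>H x i j (c + w)\<bar> \<le> K * (norm c + norm z) powr ?s" by (rule Hb')
  qed
  have b1': "\<bar>sym_rem_d u x i \<xi>\<bar> \<le> 9 * K * norm \<xi> powr ?s * norm \<xi>" for x i \<xi>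
  proof -
    have "0 \<le> K * norm \<xi> powr ?s * norm \<xi>" using K0 by simp
    then show ?thesis using b1[of x i \<xi>] by (simp add: algebra_simps)
  qed
  show thesis
    by (rule that[of "9 * K"]) (use K0 b0 b1' b2 in \<open>auto simp: mult.assoc\<close>)
qed

section \<open>The quadrature error of the remainder on a cell\<close>

text \<open>First-order expansion of R/|\<xi>|^2 from c to c + z, as pure arithmetic: \<rho> = |c|,
  t = |z|, b is the inner product of c and z, B = |c+z|^2, r and R are the numerators at the two
  points and f is the linear increment of the numerator. Working with values and increments gives a
  quadratic error without second derivatives of the quotient.\<close>

lemma quotient_expansion_bound:
  fixes r f e b t \<rho> P B R :: real
  assumes \<rho>: "0 < \<rho>" and t: "0 \<le> t" "t \<le> \<rho>" and P: "0 \<le> P"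
    and r: "\<bar>r\<bar> \<le> P * \<rho>^2" and f: "\<bar>f\<bar> \<le> 3 * P * \<rho> * t" and e: "\<bar>R - r - f\<bar> \<le> 4 * P * t^2"
    and b: "\<bar>b\<bar> \<le> \<rho> * t" and B: "B = \<rho>^2 + 2 * b + t^2" and B9: "\<rho>^2 \<le> 9 * B"
  shows "\<bar>R / B - r / \<rho>^2 - (f / \<rho>^2 - 2 * r * b / \<rho>^4)\<bar> \<le> 200 * P * t^2 / \<rho>^2"
proof -
  define E where "E = R - r - f"
  define D where "D = 2 * b + t^2"
  have Rdef: "R = r + f + E" by (simp add: E_def)
  have \<rho>2: "0 < \<rho>^2" using \<rho> by simp
  have Bpos: "0 < B" using B9 \<rho>2 by linarith
  have BD: "B = \<rho>^2 + D" by (simp add: B D_def)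
  have Dle: "\<bar>D\<bar> \<le> 3 * \<rho> * t"
  proof -
    have "t^2 \<le> \<rho> * t" using t by (simp add: power2_eq_square mult_right_mono)
    moreover have "0 \<le> t^2" by simp
    ultimately show ?thesis using b unfolding D_def by linarith
  qed
  have invB: "1 / B \<le> 9 / \<rho>^2" 
  proof -
    have "\<rho>^2 / B \<le> 9" using pos_divide_le_eq[OF Bpos, of "\<rho>^2" 9] B9 by simp
    then show ?thesis by (simp add: pos_le_divide_eq[OF \<rho>2])
  qed
  \<comment> \<open>With D = B - \<rho>^2 one has 1/B - 1/\<rho>^2 + D/\<rho>^4 = D^2/(\<rho>^4 B).
    Only the part 2b of D belongs to the linear term; its part t^2 is already of second order and
    becomes an error term.\<close>
  have id: "R / B - r / \<rho>^2 - (f / \<rho>^2 - 2 * r * b / \<rho>^4)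
     = r * (D^2 / \<rho>^4 * (1/B)) - r * (t^2 / \<rho>^4) - f * (D / \<rho>^2 * (1/B)) + E * (1/B)"
  proof -
    have "1/(A + D) - 1/A + D/A^2 = D^2/A^2 * (1/(A + D))" if "A \<noteq> 0" "A + D \<noteq> 0" for A :: real
      using that by (simp add: divide_simps) (simp add: algebra_simps power2_eq_square)
    from this[of "\<rho>^2"] have a: "1/B - 1/\<rho>^2 + D/\<rho>^4 = D^2/\<rho>^4 * (1/B)"
      using Bpos \<rho> by (simp add: BD power_mult[symmetric])
    have a2: "1/B - 1/\<rho>^2 = - (D / \<rho>^2 * (1/B))"
      unfolding BD using Bpos \<rho>2 unfolding BD by (simp add: field_simps)
    have "R / B - r / \<rho>^2 - (f / \<rho>^2 - 2 * r * b / \<rho>^4)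
      = r * (1/B - 1/\<rho>^2 + D/\<rho>^4) - r * (t^2 / \<rho>^4) + f * (1/B - 1/\<rho>^2) + E * (1/B)"
      unfolding Rdef D_def by (simp add: algebra_simps add_divide_distrib diff_divide_distrib)
    then show ?thesis unfolding a unfolding a2 by simp
  qed
  have 1: "\<bar>r * (D^2 / \<rho>^4 * (1/B))\<bar> \<le> 81 * P * t^2 / \<rho>^2"
  proof -
    have "D^2 \<le> (3 * \<rho> * t)^2" using Dle by (metis abs_ge_zero power2_abs power_mono)
    then have "\<bar>r * (D^2 / \<rho>^4 * (1/B))\<bar> \<le> (P * \<rho>^2) * ((3 * \<rho> * t)^2 / \<rho>^4 * (9 / \<rho>^2))"
      unfolding abs_mult using r P Bpos invB t \<rho>
      by (intro mult_mono r) (auto intro!: divide_right_mono mult_nonneg_nonneg)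
    also have "\<dots> = 81 * P * t^2 / \<rho>^2"
      using \<rho> by (simp add: field_simps power2_eq_square power4_eq_xxxx)
    finally show ?thesis .
  qed
  have 2: "\<bar>r * (t^2 / \<rho>^4)\<bar> \<le> P * t^2 / \<rho>^2"
  proof -
    have "\<bar>r * (t^2 / \<rho>^4)\<bar> \<le> (P * \<rho>^2) * (t^2 / \<rho>^4)"
      unfolding abs_mult using r by (intro mult_mono) (auto simp: P)
    also have "\<dots> = P * t^2 / \<rho>^2"
      using \<rho> by (simp add: field_simps power2_eq_square power4_eq_xxxx)
    finally show ?thesis .
  qed
  have 3: "\<bar>f * (D / \<rho>^2 * (1/B))\<bar> \<le> 81 * P * t^2 / \<rho>^2"
  proof -
    have "\<bar>f * (D / \<rho>^2 * (1/B))\<bar> \<le> (3 * P * \<rho> * t) * ((3 * \<rho> * t) / \<rho>^2 * (9 / \<rho>^2))"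
      unfolding abs_mult abs_divide using f P Bpos invB t \<rho> Dle
      by (intro mult_mono f) (auto intro!: divide_right_mono mult_nonneg_nonneg)
    also have "\<dots> = 81 * P * t^2 / \<rho>^2"
      using \<rho> by (simp add: field_simps power2_eq_square)
    finally show ?thesis .
  qed
  have 4: "\<bar>E * (1/B)\<bar> \<le> 36 * P * t^2 / \<rho>^2"
  proof -
    have "\<bar>E * (1/B)\<bar> \<le> (4 * P * t^2) * (9 / \<rho>^2)"
      unfolding abs_mult using e P Bpos invB by (intro mult_mono) (auto simp: E_def)
    then show ?thesis by simp
  qed
  \<comment> \<open>In units of X the four errors are 81, 1, 81 and 36, in total 199.\<close>
  define X where "X = P * t^2 / \<rho>^2"
  have X: "81 * P * t^2 / \<rho>^2 = 81 * X" "36 * P * t^2 / \<rho>^2 = 36 * X" "200 * P * t^2 / \<rho>^2 = 200 * X" "0 \<le> X"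
    using P by (simp_all add: X_def)
  show ?thesis unfolding id using 1 2 3 4 X(4) unfolding X(1-3) X_def[symmetric] by linarith
qed

text \<open>Trades the distance of a cell centre from 0 for that of a point in the cell inside a
  negative power; 8 is 2^3, for exponents down to -3.\<close>

lemma powr_double_le:
  fixes x y p :: real
  assumes "0 < x" "x \<le> 2 * y" "- 3 \<le> p" "p \<le> 0"
  shows "y powr p \<le> 8 * x powr p"
proof -
  have "y powr p \<le> (x / 2) powr p" using assms by (intro powr_mono2') auto
  also have "\<dots> = 2 powr (- p) * x powr p"
    using assms by (simp add: powr_divide powr_minus field_simps)
  also have "\<dots> \<le> 2 powr 3 * x powr p"
    using assms by (intro mult_right_mono powr_mono) auto
  finally show ?thesis by simp
qed

lemma powr_lipschitz:
  fixes x y p m :: real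
  assumes m: "0 < m" "m \<le> x" "m \<le> y" and p: "0 \<le> p"
  shows "\<bar>x powr (- p) - y powr (- p)\<bar> \<le> p * m powr (- p - 1) * \<bar>x - y\<bar>"
proof -
  have "norm (x powr (- p) - y powr (- p)) \<le> (p * m powr (- p - 1)) * norm (x - y)"
  proof (rule field_differentiable_bound[where S = "{m..}" and f'="\<lambda>t. - p * t powr (- p - 1)"])
    fix t assume "t \<in> {m..}"
    then show "((\<lambda>t. t powr (- p)) has_field_derivative - p * t powr (- p - 1)) (at t within {m..})"
      using m by (auto intro!: derivative_eq_intros)
    show "norm (- p * t powr (- p - 1)) \<le> p * m powr (- p - 1)"
      using \<open>t \<in> {m..}\<close> m p by (auto simp: abs_mult intro!: mult_left_mono powr_mono2')
  qed (use m in auto)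
  then show ?thesis by simp
qed

lemma lborel_distr_reflect:
  fixes c :: "'a::euclidean_space"
  shows "distr lborel borel (\<lambda>x. c - x) = lborel"
  by (subst lborel_affine[of "-1" c], auto simp: density_1)

text \<open>The point reflection about c maps the box to itself and changes the sign of the
  integrand.\<close>

lemma integral_centered_cbox_component:
  fixes c d :: "real^3"
  shows "set_lebesgue_integral lborel (cbox (c - d) (c + d)) (\<lambda>\<xi>. (\<xi> - c)$i) = 0" (is "?I = 0")
proof -
  let ?g = "\<lambda>\<xi>. indicat_real (cbox (c - d) (c + d)) \<xi> *\<^sub>R (\<xi> - c)$i"
  have "?I = (\<integral>\<xi>. ?g \<xi> \<partial>distr lborel borel (\<lambda>x. (c + c) - x))"
    by (simp add: lborel_distr_reflect set_lebesgue_integral_def)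
  also have "\<dots> = (\<integral>\<xi>. ?g (c + c - \<xi>) \<partial>lborel)"
    by (rule integral_distr) auto
  also have "\<dots> = (\<integral>\<xi>. - ?g \<xi> \<partial>lborel)"
  proof (rule Bochner_Integration.integral_cong)
    fix \<xi>
    have "c + c - \<xi> \<in> cbox (c - d) (c + d) \<longleftrightarrow> \<xi> \<in> cbox (c - d) (c + d)"
      by (auto simp: mem_box_cart algebra_simps)
    then show "?g (c + c - \<xi>) = - ?g \<xi>" by (simp add: indicator_def)
  qed simp
  also have "\<dots> = - ?I" by (simp add: set_lebesgue_integral_def)
  finally show ?thesis by simp
qed

lemma set_integrable_norm_powr:
  fixes A :: "(real^3) set"
  assumes "bounded A" "A \<in> sets borel" "- 3 < p" "p \<le> 0"
  shows "set_integrable lborel A (\<lambda>\<xi>. norm \<xi> powr p)"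
proof -
  obtain r where r: "\<And>\<xi>. \<xi> \<in> A \<Longrightarrow> norm \<xi> \<le> r" using \<open>bounded A\<close> by (auto simp: bounded_iff)
  have "set_integrable lborel {z::real^3. norm z \<le> r} (\<lambda>z. norm z powr (- (- p)))"
    using assms by (intro integrable_norm_powr_near_0) auto
  then have "set_integrable lborel A (\<lambda>z. norm z powr (- (- p)))"
    by (rule set_integrable_subset) (use assms r in auto)
  then show ?thesis by simp
qed

lemma
  fixes f :: "'i \<Rightarrow> 'a \<Rightarrow> real"
  assumes "\<And>i. i \<in> I \<Longrightarrow> set_integrable M A (f i)"
  shows set_integrable_sum: "set_integrable M A (\<lambda>x. \<Sum>i\<in>I. f i x)"
    and set_integral_sum: "(LINT x:A|M. \<Sum>i\<in>I. f i x) = (\<Sum>i\<in>I. LINT x:A|M. f i x)"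
  using assms unfolding set_integrable_def set_lebesgue_integral_def
  by (simp_all add: sum_distrib_left)

lemma set_integral_abs_le:
  fixes f :: "'a \<Rightarrow> real"
  assumes "set_integrable M A f"
  shows "\<bar>LINT x:A|M. f x\<bar> \<le> (LINT x:A|M. \<bar>f x\<bar>)"
  using integral_norm_bound[of M "\<lambda>x. indicator A x *\<^sub>R f x"]
  by (simp add: set_lebesgue_integral_def abs_mult)

lemma omega_measurable [measurable]: "omega \<alpha> \<gamma> \<in> borel_measurable borel"
  unfolding omega_def by measurable

lemma omega_set_integrable:
  assumes "0 < \<alpha>" "\<alpha> < 2" "bounded A" "A \<in> sets borel"
  shows "set_integrable lborel A (omega \<alpha> 2)"
  unfolding omega_def using assms by (intro set_integrable_norm_powr) auto

text \<open>Collects what the quadrature estimate needs from \<open>sym_rem u x\<close> at one fixed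
  x. F enters as the gradient of R only through the expansion \<open>RF\<close>, and K is a
  parameter so that all x can share it.\<close>

locale remainder =
  fixes \<alpha> \<epsilon> K :: real and R :: "real^3 \<Rightarrow> real" and F :: "3 \<Rightarrow> real^3 \<Rightarrow> real"
  assumes \<alpha>: "0 < \<alpha>" "\<alpha> < 2" and \<epsilon>: "0 < \<epsilon>" "\<epsilon> \<le> 1" "\<alpha> + \<epsilon> \<le> 2" and K: "0 \<le> K"
    and Rm [measurable]: "R \<in> borel_measurable borel"
    and R: "\<bar>R \<xi>\<bar> \<le> K * norm \<xi> powr (\<alpha> + \<epsilon>) * norm \<xi>^2"
    and F: "\<bar>F i \<xi>\<bar> \<le> K * norm \<xi> powr (\<alpha> + \<epsilon>) * norm \<xi>"
    and RF: "\<bar>R (c + z) - R c - (\<Sum>i\<in>UNIV. F i c * z$i)\<bar> \<le> K * (norm c + norm z) powr (\<alpha> + \<epsilon>) * norm z^2"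
begin

definition \<phi> :: "real^3 \<Rightarrow> real" where "\<phi> \<xi> = norm \<xi> powr (- 2) * R \<xi>"

lemma \<phi>_measurable [measurable]: "\<phi> \<in> borel_measurable borel"
  unfolding \<phi>_def by measurable

text \<open>Holds at 0 as well, where both sides have the default value 0.\<close>

lemma powr_minus_2: "0 \<le> x \<Longrightarrow> x powr (- 2) = 1 / x^2" for x :: real
  by (cases "x = 0") (auto simp: powr_minus powr_numeral field_simps)

lemma \<phi>_bound: "\<bar>\<phi> \<xi>\<bar> \<le> K * norm \<xi> powr (\<alpha> + \<epsilon>)"
proof (cases "\<xi> = 0")
  case False
  have "\<bar>\<phi> \<xi>\<bar> = \<bar>R \<xi>\<bar> / norm \<xi>^2" by (simp add: \<phi>_def powr_minus_2 abs_mult)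
  also have "\<dots> \<le> K * norm \<xi> powr (\<alpha> + \<epsilon>)" using R[of \<xi>] False by (simp add: field_simps)
  finally show ?thesis .
qed (simp add: \<phi>_def)

lemma \<phi>_omega_bound: "\<bar>\<phi> \<xi> * omega \<alpha> 2 \<xi>\<bar> \<le> K * norm \<xi> powr (\<epsilon> - 1)"
proof -
  have "\<bar>\<phi> \<xi> * omega \<alpha> 2 \<xi>\<bar> \<le> (K * norm \<xi> powr (\<alpha> + \<epsilon>)) * norm \<xi> powr (2 - (3 + \<alpha>))"
    unfolding abs_mult omega_def using \<phi>_bound K by (intro mult_mono) auto
  also have "\<dots> = K * norm \<xi> powr ((\<alpha> + \<epsilon>) + (2 - (3 + \<alpha>)))"
    by (simp only: powr_add mult.assoc)
  also have "(\<alpha> + \<epsilon>) + (2 - (3 + \<alpha>)) = \<epsilon> - 1" by simp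
  finally show ?thesis .
qed

lemma \<phi>_omega_integrable:
  assumes "bounded A" "A \<in> sets borel"
  shows "set_integrable lborel A (\<lambda>\<xi>. \<phi> \<xi> * omega \<alpha> 2 \<xi>)"
proof -
  have "set_integrable lborel A (\<lambda>\<xi>. K * norm \<xi> powr (\<epsilon> - 1))"
    using assms \<epsilon> by (intro set_integrable_mult_right set_integrable_norm_powr) auto
  then show ?thesis
    by (rule set_integrable_bound)
       (use assms \<phi>_omega_bound K in \<open>auto simp: set_borel_measurable_def abs_mult\<close>)
qed

text \<open>The quotient rule for R/|\<xi>|^2 with F in place of the gradient of R; it serves as the
  coefficient vector of the linear approximation.\<close>

definition grad\<phi> :: "real^3 \<Rightarrow> real^3" where
  "grad\<phi> c = (\<chi> i. F i c / norm c^2 - 2 * R c * c$i / norm c^4)"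

text \<open>The instance P = K |c|^(\<alpha>+\<epsilon>) of \<open>quotient_expansion_bound\<close>;
  dividing by |c|^2 turns P into the power \<alpha>+\<epsilon>-2. In the second bound, 5 = 3 + 2:
  three from F, two from differentiating the denominator.\<close>

lemma \<phi>_taylor:
  assumes c: "c \<noteq> 0" and z: "norm z \<le> 2/3 * norm c"
  shows "\<bar>\<phi> (c + z) - \<phi> c - (\<Sum>i\<in>UNIV. grad\<phi> c$i * z$i)\<bar> \<le> 200 * K * norm c powr (\<alpha> + \<epsilon> - 2) * norm z^2"
    and "\<bar>\<Sum>i\<in>UNIV. grad\<phi> c$i * z$i\<bar> \<le> 5 * K * norm c powr (\<alpha> + \<epsilon> - 1) * norm z"
proof -
  define \<rho> t P where "\<rho> = norm c" and "t = norm z" and "P = K * norm c powr (\<alpha> + \<epsilon>)"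
  define f where "f = (\<Sum>i\<in>UNIV. F i c * z$i)"
  have \<rho>: "0 < \<rho>" using c by (simp add: \<rho>_def)
  have t: "0 \<le> t" "t \<le> 2/3 * \<rho>" using z by (simp_all add: t_def \<rho>_def)
  have P: "0 \<le> P" using K by (simp add: P_def)
  have cz: "\<bar>c \<bullet> z\<bar> \<le> \<rho> * t" using Cauchy_Schwarz_ineq2[of c z] by (simp add: \<rho>_def t_def)
  have f: "\<bar>f\<bar> \<le> 3 * P * \<rho> * t"
  proof -
    have "\<bar>f\<bar> \<le> (\<Sum>i\<in>(UNIV::3 set). P * \<rho> * t)"
      unfolding f_def
    proof (rule order_trans[OF sum_abs sum_mono])
      fix i :: 3
      show "\<bar>F i c * z$i\<bar> \<le> P * \<rho> * t"
        unfolding abs_mult using F[of i c] component_le_norm_cart[of z i] P \<rho>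
        by (intro mult_mono) (auto simp: P_def \<rho>_def t_def)
    qed
    then show ?thesis by simp
  qed
  have r: "\<bar>R c\<bar> \<le> P * \<rho>^2" using R[of c] by (simp add: P_def \<rho>_def)
  \<comment> \<open>Since t \<le> \<rho> and \<alpha>+\<epsilon> \<le> 2, the ball radius \<rho>+t
    costs at most a factor 2^2 = 4.\<close>
  have e: "\<bar>R (c + z) - R c - f\<bar> \<le> 4 * P * t^2"
  proof -
    have "(\<rho> + t) powr (\<alpha> + \<epsilon>) \<le> (2 * \<rho>) powr (\<alpha> + \<epsilon>)"
      using t \<rho> \<alpha> \<epsilon> by (intro powr_mono2) auto
    also have "\<dots> = 2 powr (\<alpha> + \<epsilon>) * \<rho> powr (\<alpha> + \<epsilon>)" using \<rho> by (simp add: powr_mult)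
    also have "\<dots> \<le> 2 powr 2 * \<rho> powr (\<alpha> + \<epsilon>)"
      using \<epsilon> by (intro mult_right_mono powr_mono) auto
    finally have "K * (\<rho> + t) powr (\<alpha> + \<epsilon>) * t^2 \<le> K * (4 * \<rho> powr (\<alpha> + \<epsilon>)) * t^2"
      using K by (intro mult_right_mono mult_left_mono) auto
    then show ?thesis using RF[of c z] by (simp add: f_def \<rho>_def t_def P_def)
  qed
  have B: "norm (c + z)^2 = \<rho>^2 + 2 * (c \<bullet> z) + t^2"
    unfolding \<rho>_def t_def power2_norm_eq_inner by (simp add: inner_add inner_commute)
  \<comment> \<open>The restriction |z| \<le> 2|c|/3 keeps c + z at distance at least |c|/3 from
    0.\<close>
  have B9: "\<rho>^2 \<le> 9 * norm (c + z)^2"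
  proof -
    have "\<rho> \<le> norm (c + z) + t" using norm_triangle_ineq4[of "c + z" z] by (simp add: \<rho>_def t_def)
    then have "\<rho> \<le> 3 * norm (c + z)" using t by linarith
    then have "\<rho>^2 \<le> (3 * norm (c + z))^2" using \<rho> by (intro power_mono) auto
    then show ?thesis by (simp add: power_mult_distrib)
  qed
  have gz: "(\<Sum>i\<in>UNIV. grad\<phi> c$i * z$i) = f / \<rho>^2 - 2 * R c * (c \<bullet> z) / \<rho>^4"
  proof -
    have "(\<Sum>i\<in>UNIV. grad\<phi> c$i * z$i) = (\<Sum>i\<in>UNIV. F i c * z$i / \<rho>^2 - 2 * R c / \<rho>^4 * (c$i * z$i))"
      by (simp add: grad\<phi>_def \<rho>_def field_simps)
    also have "\<dots> = f / \<rho>^2 - 2 * R c / \<rho>^4 * (c \<bullet> z)"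
      by (simp add: sum_subtractf f_def inner_vec_def sum_distrib_left sum_divide_distrib)
    finally show ?thesis by simp
  qed
  have "\<bar>R (c + z) / norm (c + z)^2 - R c / \<rho>^2 - (f / \<rho>^2 - 2 * R c * (c \<bullet> z) / \<rho>^4)\<bar> \<le> 200 * P * t^2 / \<rho>^2"
    by (rule quotient_expansion_bound[OF \<rho> t(1) _ P r f e cz B B9]) (use t \<rho> in linarith)
  moreover have "200 * P * t^2 / \<rho>^2 = 200 * K * norm c powr (\<alpha> + \<epsilon> - 2) * norm z^2"
  proof -
    have "P / \<rho>^2 = K * norm c powr (\<alpha> + \<epsilon> - 2)"
      using c by (simp add: P_def \<rho>_def powr_diff powr_numeral)
    moreover have "200 * P * t^2 / \<rho>^2 = 200 * (P / \<rho>^2) * t^2" by simp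
    ultimately show ?thesis by (simp add: t_def)
  qed
  ultimately show "\<bar>\<phi> (c + z) - \<phi> c - (\<Sum>i\<in>UNIV. grad\<phi> c$i * z$i)\<bar> \<le> 200 * K * norm c powr (\<alpha> + \<epsilon> - 2) * norm z^2"
    unfolding gz by (simp add: \<phi>_def powr_minus_2 \<rho>_def t_def)
  have "\<bar>f / \<rho>^2\<bar> \<le> 3 * P * \<rho> * t / \<rho>^2"
    using f by (simp add: divide_right_mono)
  moreover have "\<bar>2 * R c * (c \<bullet> z) / \<rho>^4\<bar> \<le> 2 * (P * \<rho>^2) * (\<rho> * t) / \<rho>^4"
  proof -
    have "\<bar>2 * R c * (c \<bullet> z)\<bar> \<le> 2 * (P * \<rho>^2) * (\<rho> * t)"
      unfolding abs_mult using r cz P \<rho> t by (intro mult_mono) auto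
    then show ?thesis by (simp add: divide_right_mono)
  qed
  moreover have "3 * P * \<rho> * t / \<rho>^2 = 3 * (P / \<rho> * t)" "2 * (P * \<rho>^2) * (\<rho> * t) / \<rho>^4 = 2 * (P / \<rho> * t)"
    using \<rho> by (simp_all add: field_simps power2_eq_square power4_eq_xxxx)
  moreover have "5 * K * norm c powr (\<alpha> + \<epsilon> - 1) * norm z = 5 * (P / \<rho> * t)"
    using c by (simp add: P_def \<rho>_def t_def powr_diff)
  ultimately show "\<bar>\<Sum>i\<in>UNIV. grad\<phi> c$i * z$i\<bar> \<le> 5 * K * norm c powr (\<alpha> + \<epsilon> - 1) * norm z"
    unfolding gz by linarith
qed

text \<open>The corners are symmetric about the centre, so the linear terms of the expansion cancel.
  Each corner is at distance sqrt(3) h/2 \<le> h \<le> 2|c|/3 from c, so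
  \<open>\<phi>_taylor\<close> applies.\<close>

lemma corner_average:
  assumes c: "3/2 * h \<le> norm c" and h: "0 < h"
  shows "\<bar>1/8 * (\<Sum>\<sigma>\<in>signs. \<phi> (c + (h/2) *\<^sub>R \<sigma>)) - \<phi> c\<bar> \<le> 200 * K * norm c powr (\<alpha> + \<epsilon> - 2) * h^2"
proof -
  let ?d = "\<lambda>\<sigma>. \<phi> (c + (h/2) *\<^sub>R \<sigma>) - \<phi> c - (\<Sum>i\<in>UNIV. grad\<phi> c$i * ((h/2) *\<^sub>R \<sigma>)$i)"
  let ?b = "200 * K * norm c powr (\<alpha> + \<epsilon> - 2) * h^2"
  have c0: "c \<noteq> 0" using c h by auto
  have z: "norm ((h/2) *\<^sub>R \<sigma>) \<le> h" if "\<sigma> \<in> signs" for \<sigma>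
  proof -
    have "\<sigma>$i * \<sigma>$i = 1" for i
      using abs_signs[OF that, of i] by (metis abs_mult_self_eq mult_1)
    then have "norm \<sigma>^2 = 3"
      unfolding power2_norm_eq_inner inner_vec_def inner_real_def by simp
    then have "norm \<sigma>^2 \<le> 2^2" by simp
    then have "norm \<sigma> \<le> 2" by (rule power2_le_imp_le) simp
    then show ?thesis using h by simp
  qed
  have "(\<Sum>\<sigma>\<in>signs. \<Sum>i\<in>UNIV. grad\<phi> c$i * ((h/2) *\<^sub>R \<sigma>)$i) = 0"
  proof -
    have "(\<Sum>\<sigma>\<in>signs. \<Sum>i\<in>UNIV. grad\<phi> c$i * ((h/2) *\<^sub>R \<sigma>)$i) = (\<Sum>i\<in>UNIV. grad\<phi> c$i * (h/2) * (\<Sum>\<sigma>\<in>signs. \<sigma>$i))"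
      by (subst sum.swap) (simp add: sum_distrib_left mult.assoc)
    then show ?thesis by (simp add: sum_signs_component)
  qed
  then have eq: "1/8 * (\<Sum>\<sigma>\<in>signs. \<phi> (c + (h/2) *\<^sub>R \<sigma>)) - \<phi> c = 1/8 * (\<Sum>\<sigma>\<in>signs. ?d \<sigma>)"
    by (simp add: sum_subtractf card_signs)
  have "\<bar>1/8 * (\<Sum>\<sigma>\<in>signs. ?d \<sigma>)\<bar> \<le> 1/8 * (\<Sum>\<sigma>\<in>signs. ?b)"
  proof -
    have "\<bar>\<Sum>\<sigma>\<in>signs. ?d \<sigma>\<bar> \<le> (\<Sum>\<sigma>\<in>signs. ?b)"
    proof (rule order_trans[OF sum_abs sum_mono])
      fix \<sigma> assume s: "\<sigma> \<in> signs"
      have "norm ((h/2) *\<^sub>R \<sigma>) \<le> 2/3 * norm c" using z[OF s] c by linarith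
      then have "\<bar>?d \<sigma>\<bar> \<le> 200 * K * norm c powr (\<alpha> + \<epsilon> - 2) * norm ((h/2) *\<^sub>R \<sigma>)^2"
        by (rule \<phi>_taylor[OF c0])
      also have "\<dots> \<le> ?b" using K z[OF s] by (intro mult_left_mono power_mono) auto
      finally show "\<bar>?d \<sigma>\<bar> \<le> ?b" .
    qed
    then show ?thesis unfolding abs_mult by (intro mult_mono) auto
  qed
  then show ?thesis unfolding eq by (simp add: card_signs mult_ac)
qed

text \<open>The linear part of \<^term>\<open>\<phi>\<close> is antisymmetric about the centre of the cell, so it only
  contributes through the oscillation of the weight.\<close>

lemma cell_quadrature_pointwise:
  assumes c: "3/2 * h \<le> norm c" and h: "0 < h" and z: "norm z \<le> h"
  defines "M \<equiv> 1/8 * (\<Sum>\<sigma>\<in>signs. \<phi> (c + (h/2) *\<^sub>R \<sigma>))"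
  shows "\<bar>(\<phi> (c + z) - M) * omega \<alpha> 2 (c + z) - omega \<alpha> 2 c * (\<Sum>i\<in>UNIV. grad\<phi> c$i * z$i)\<bar>
     \<le> 20000 * K * h^2 * norm (c + z) powr (\<epsilon> - 3)"
proof -
  let ?l = "\<Sum>i\<in>UNIV. grad\<phi> c$i * z$i"
  define x \<rho> where "x = norm (c + z)" and "\<rho> = norm c"
  have c0: "c \<noteq> 0" using c h by auto
  have \<rho>: "0 < \<rho>" using c0 by (simp add: \<rho>_def)
  have z': "norm z \<le> 2/3 * norm c" using z c by linarith
  have x1: "\<rho> \<le> 3 * x" using norm_triangle_ineq4[of "c + z" z] z' by (simp add: x_def \<rho>_def)
  have x2: "x \<le> 2 * \<rho>" using norm_triangle_ineq[of c z] z' norm_ge_zero[of c] unfolding x_def \<rho>_def by linarith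
  have x0: "0 < x" using x1 \<rho> by linarith
  have om: "omega \<alpha> 2 (c + z) = x powr (- (1 + \<alpha>))" "omega \<alpha> 2 c = \<rho> powr (- (1 + \<alpha>))"
    by (simp_all add: omega_def x_def \<rho>_def algebra_simps)
  \<comment> \<open>Second-order errors (Taylor remainder and corner average) are multiplied by the
    full weight; the linear part is multiplied only by the change of the weight, which supplies the
    second factor h.\<close>
  have split: "(\<phi> (c + z) - M) * omega \<alpha> 2 (c + z) - omega \<alpha> 2 c * ?l
    = (\<phi> (c + z) - \<phi> c - ?l + (\<phi> c - M)) * omega \<alpha> 2 (c + z) + ?l * (omega \<alpha> 2 (c + z) - omega \<alpha> 2 c)"
    by (simp add: algebra_simps)
  \<comment> \<open>3200 = 8 * (200 + 200): Taylor remainder plus corner average, with the factor 8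
    of \<open>powr_double_le\<close>.\<close>
  have A: "\<bar>(\<phi> (c + z) - \<phi> c - ?l + (\<phi> c - M)) * omega \<alpha> 2 (c + z)\<bar> \<le> 3200 * K * h^2 * x powr (\<epsilon> - 3)"
  proof -
    have "\<bar>\<phi> (c + z) - \<phi> c - ?l\<bar> \<le> 200 * K * \<rho> powr (\<alpha> + \<epsilon> - 2) * norm z^2"
      unfolding \<rho>_def by (rule \<phi>_taylor[OF c0 z'])
    also have "\<dots> \<le> 200 * K * \<rho> powr (\<alpha> + \<epsilon> - 2) * h^2"
      using K z by (intro mult_left_mono power_mono) auto
    finally have "\<bar>\<phi> (c + z) - \<phi> c - ?l + (\<phi> c - M)\<bar> \<le> 400 * K * h^2 * \<rho> powr (\<alpha> + \<epsilon> - 2)"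
      using corner_average[OF c h] unfolding M_def \<rho>_def by (simp add: abs_le_iff algebra_simps)
    also have "\<dots> \<le> 400 * K * h^2 * (8 * x powr (\<alpha> + \<epsilon> - 2))"
      using K x0 x2 \<alpha> \<epsilon> by (intro mult_left_mono powr_double_le) auto
    finally have "\<bar>(\<phi> (c + z) - \<phi> c - ?l + (\<phi> c - M)) * omega \<alpha> 2 (c + z)\<bar>
        \<le> 400 * K * h^2 * (8 * x powr (\<alpha> + \<epsilon> - 2)) * x powr (- (1 + \<alpha>))"
      unfolding abs_mult om by (intro mult_mono) auto
    also have "\<dots> = 3200 * K * h^2 * (x powr (\<alpha> + \<epsilon> - 2) * x powr (- (1 + \<alpha>)))" by simp
    also have "x powr (\<alpha> + \<epsilon> - 2) * x powr (- (1 + \<alpha>)) = x powr (\<epsilon> - 3)"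
      by (simp add: powr_add[symmetric])
    finally show ?thesis .
  qed
  \<comment> \<open>9720 = 8 * 5 * 243: the gradient bound 5, the Lipschitz constant of the weight 3
    * 3^4 (from 1+\<alpha> \<le> 3 and 3^(2+\<alpha>) \<le> 81, because points of the cell may be as
    close to 0 as \<rho>/3), and again 8.\<close>
  have B: "\<bar>?l * (omega \<alpha> 2 (c + z) - omega \<alpha> 2 c)\<bar> \<le> 9720 * K * h^2 * x powr (\<epsilon> - 3)"
  proof -
    have l: "\<bar>?l\<bar> \<le> 5 * K * \<rho> powr (\<alpha> + \<epsilon> - 1) * h"
      using \<phi>_taylor(2)[OF c0 z'] z K unfolding \<rho>_def
      by (meson mult_left_mono mult_nonneg_nonneg order_trans powr_ge_zero zero_le_numeral)
    have "\<bar>x powr (- (1 + \<alpha>)) - \<rho> powr (- (1 + \<alpha>))\<bar> \<le> (1 + \<alpha>) * (\<rho> / 3) powr (- (1 + \<alpha>) - 1) * \<bar>x - \<rho>\<bar>"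
      using x1 \<rho> \<alpha> by (intro powr_lipschitz) auto
    also have "\<dots> \<le> 3 * (81 * \<rho> powr (- (1 + \<alpha>) - 1)) * h"
    proof (intro mult_mono)
      have "(\<rho> / 3) powr (- (1 + \<alpha>) - 1) = 3 powr (2 + \<alpha>) * \<rho> powr (- (1 + \<alpha>) - 1)"
        using \<rho> by (simp add: powr_divide powr_minus powr_diff powr_add field_simps)
      also have "\<dots> \<le> 3 powr 4 * \<rho> powr (- (1 + \<alpha>) - 1)"
        using \<alpha> by (intro mult_right_mono powr_mono) auto
      finally show "(\<rho> / 3) powr (- (1 + \<alpha>) - 1) \<le> 81 * \<rho> powr (- (1 + \<alpha>) - 1)" by simp
      have "\<bar>x - \<rho>\<bar> \<le> norm z" unfolding x_def \<rho>_def using norm_triangle_ineq3[of "c + z" c] by simp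
      then show "\<bar>x - \<rho>\<bar> \<le> h" using z by linarith
    qed (use \<alpha> h in auto)
    finally have o: "\<bar>omega \<alpha> 2 (c + z) - omega \<alpha> 2 c\<bar> \<le> 243 * \<rho> powr (- (1 + \<alpha>) - 1) * h"
      unfolding om by simp
    have "\<bar>?l * (omega \<alpha> 2 (c + z) - omega \<alpha> 2 c)\<bar>
       \<le> (5 * K * \<rho> powr (\<alpha> + \<epsilon> - 1) * h) * (243 * \<rho> powr (- (1 + \<alpha>) - 1) * h)"
      unfolding abs_mult using l o K h by (intro mult_mono) auto
    also have "\<dots> = 1215 * K * h^2 * (\<rho> powr (\<alpha> + \<epsilon> - 1) * \<rho> powr (- (1 + \<alpha>) - 1))"
      by (simp add: power2_eq_square)
    also have "\<rho> powr (\<alpha> + \<epsilon> - 1) * \<rho> powr (- (1 + \<alpha>) - 1) = \<rho> powr (\<epsilon> - 3)"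
      by (simp add: powr_add[symmetric])
    also have "1215 * K * h^2 * \<dots> \<le> 1215 * K * h^2 * (8 * x powr (\<epsilon> - 3))"
      using K x0 x2 \<epsilon> by (intro mult_left_mono powr_double_le) auto
    finally show ?thesis by simp
  qed
  \<comment> \<open>3200 + 9720 stays below 20000.\<close>
  have "0 \<le> K * h^2 * x powr (\<epsilon> - 3)" using K by simp
  then show ?thesis
    using A B unfolding split x_def by (simp add: abs_le_iff)
qed

text \<open>Subtracting \<open>omega \<alpha> 2 c\<close> times the linear part changes no integral,
  since that part has mean zero on the centred cell. What is left is the pointwise estimate,
  integrated.\<close>

lemma cell_quadrature_error:
  assumes c: "3/2 * h \<le> norm c" and h: "0 < h"
  defines "Q \<equiv> cbox (c - pt3 (h/2) (h/2) (h/2)) (c + pt3 (h/2) (h/2) (h/2))"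
  shows "\<bar>(LINT \<xi>:Q|lborel. \<phi> \<xi> * omega \<alpha> 2 \<xi>)
       - 1/8 * (\<Sum>\<sigma>\<in>signs. \<phi> (c + (h/2) *\<^sub>R \<sigma>)) * (LINT \<xi>:Q|lborel. omega \<alpha> 2 \<xi>)\<bar>
     \<le> 20000 * K * h^2 * (LINT \<xi>:Q|lborel. norm \<xi> powr (\<epsilon> - 3))"
proof -
  define M where "M = 1/8 * (\<Sum>\<sigma>\<in>signs. \<phi> (c + (h/2) *\<^sub>R \<sigma>))"
  let ?l = "\<lambda>\<xi>. \<Sum>i\<in>UNIV. grad\<phi> c$i * (\<xi> - c)$i"
  have Q: "bounded Q" "Q \<in> sets borel" by (auto simp: Q_def)
  have i1: "set_integrable lborel Q (\<lambda>\<xi>. \<phi> \<xi> * omega \<alpha> 2 \<xi>)" by (rule \<phi>_omega_integrable[OF Q])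
  have i2: "set_integrable lborel Q (omega \<alpha> 2)" by (rule omega_set_integrable[OF \<alpha> Q])
  have i3: "set_integrable lborel Q (\<lambda>\<xi>. (\<xi> - c)$i)" for i
    unfolding Q_def set_integrable_def
    by (rule borel_integrable_compact) (auto intro!: continuous_intros)
  have i3': "set_integrable lborel Q ?l"
    by (intro set_integrable_sum set_integrable_mult_right i3)
  have l0: "(LINT \<xi>:Q|lborel. ?l \<xi>) = 0"
  proof -
    have "(LINT \<xi>:Q|lborel. ?l \<xi>) = (\<Sum>i\<in>UNIV. (LINT \<xi>:Q|lborel. grad\<phi> c$i * (\<xi> - c)$i))"
      by (intro set_integral_sum set_integrable_mult_right i3)
    then show ?thesis by (simp add: integral_centered_cbox_component[simplified] Q_def)
  qed
  have i4: "set_integrable lborel Q (\<lambda>\<xi>. (\<phi> \<xi> * omega \<alpha> 2 \<xi> - M * omega \<alpha> 2 \<xi>) - omega \<alpha> 2 c * ?l \<xi>)"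
    by (intro set_integral_diff set_integrable_mult_right i1 i2 i3')
  have "(LINT \<xi>:Q|lborel. (\<phi> \<xi> * omega \<alpha> 2 \<xi> - M * omega \<alpha> 2 \<xi>) - omega \<alpha> 2 c * ?l \<xi>)
     = (LINT \<xi>:Q|lborel. \<phi> \<xi> * omega \<alpha> 2 \<xi>) - M * (LINT \<xi>:Q|lborel. omega \<alpha> 2 \<xi>)"
    using i1 i2 i3' l0 by (simp add: set_integral_diff set_integrable_mult_right)
  moreover have "\<bar>LINT \<xi>:Q|lborel. (\<phi> \<xi> * omega \<alpha> 2 \<xi> - M * omega \<alpha> 2 \<xi>) - omega \<alpha> 2 c * ?l \<xi>\<bar>
     \<le> (LINT \<xi>:Q|lborel. 20000 * K * h^2 * norm \<xi> powr (\<epsilon> - 3))"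
  proof -
    have b: "\<bar>(\<phi> \<xi> * omega \<alpha> 2 \<xi> - M * omega \<alpha> 2 \<xi>) - omega \<alpha> 2 c * ?l \<xi>\<bar> \<le> 20000 * K * h^2 * norm \<xi> powr (\<epsilon> - 3)"
      if "\<xi> \<in> Q" for \<xi>
    proof -
      have "\<bar>(\<xi> - c)$i\<bar> \<le> h/2" for i
        using that exhaust_3[of i] unfolding Q_def mem_box_cart abs_le_iff
        by (auto simp: pt3_def forall_3)
      then have "(\<Sum>i\<in>UNIV. ((\<xi> - c)$i)^2) \<le> (\<Sum>i\<in>(UNIV::3 set). (h/2)^2)"
        by (intro sum_mono) (metis abs_ge_zero power2_abs power_mono)
      also have "\<dots> \<le> h^2" by (simp add: power2_eq_square)
      also have "(\<Sum>i\<in>UNIV. ((\<xi> - c)$i)^2) = norm (\<xi> - c)^2"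
        by (simp only: power2_norm_eq_inner inner_vec_def inner_real_def) (simp only: power2_eq_square)
      finally have "norm (\<xi> - c)^2 \<le> h^2" .
      then have "norm (\<xi> - c) \<le> h" using h by (auto intro: power2_le_imp_le)
      from cell_quadrature_pointwise[OF c h this] show ?thesis
        by (simp add: M_def algebra_simps)
    qed
    have i5: "set_integrable lborel Q (\<lambda>\<xi>. 20000 * K * h^2 * norm \<xi> powr (\<epsilon> - 3))"
      using Q \<epsilon> by (intro set_integrable_mult_right set_integrable_norm_powr) auto
    have "\<bar>LINT \<xi>:Q|lborel. (\<phi> \<xi> * omega \<alpha> 2 \<xi> - M * omega \<alpha> 2 \<xi>) - omega \<alpha> 2 c * ?l \<xi>\<bar>
      \<le> (LINT \<xi>:Q|lborel. \<bar>(\<phi> \<xi> * omega \<alpha> 2 \<xi> - M * omega \<alpha> 2 \<xi>) - omega \<alpha> 2 c * ?l \<xi>\<bar>)"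
      by (rule set_integral_abs_le[OF i4])
    also have "\<dots> \<le> (LINT \<xi>:Q|lborel. 20000 * K * h^2 * norm \<xi> powr (\<epsilon> - 3))"
      using b by (intro set_integral_mono set_integrable_abs i4 i5) auto
    finally show ?thesis by simp
  qed
  ultimately show ?thesis unfolding M_def by simp
qed

end

section \<open>Reduction to the octant and to grid cells\<close>

definition octant :: "(real^3) set" where
  "octant = {\<xi>. \<forall>i. 0 \<le> \<xi>$i}"

lemma octant_measurable [measurable]: "octant \<in> sets borel"
proof -
  have "closed octant" unfolding octant_def by (intro closed_Collect_all closed_Collect_le continuous_intros)
  then show ?thesis by simp
qed

lemma linear_vec_mult: "linear (\<lambda>z::real^3. \<sigma> * z)"
  by (rule linearI) (auto simp: vec_eq_iff algebra_simps)

lemma vec_mult_measurable [measurable]: "(\<lambda>z::real^3. \<sigma> * z) \<in> borel_measurable borel"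
  by (intro borel_measurable_continuous_onI linear_continuous_on linear_conv_bounded_linear[THEN iffD1] linear_vec_mult)

lemma signs_mult_orthogonal:
  assumes "\<sigma> \<in> signs"
  shows "orthogonal_transformation (\<lambda>z::real^3. \<sigma> * z)"
  unfolding orthogonal_transformation
  using linear_vec_mult norm_signs_mult[OF assms] by simp

lemma signs_mult_self: "\<sigma> \<in> signs \<Longrightarrow> \<sigma> * (\<sigma> * z) = (z::real^3)"
proof -
  assume s: "\<sigma> \<in> signs"
  have "\<sigma>$i * (\<sigma>$i * z$i) = z$i" for i
    using s unfolding signs_def by (metis (mono_tags, lifting) mem_Collect_eq mult_1 mult_minus1 minus_minus)
  then show ?thesis by (simp add: vec_eq_iff)
qed

text \<open>Off the coordinate planes exactly one reflection moves z into the octant: the vector of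
  the signs of its components.\<close>

lemma sum_signs_octant:
  assumes z: "\<forall>i. (z::real^3)$i \<noteq> 0"
  shows "(\<Sum>\<sigma>\<in>signs. indicat_real octant (\<sigma> * z)) = 1"
proof -
  define s0 :: "real^3" where "s0 = (\<chi> i. sgn (z$i))"
  have s0: "s0 \<in> signs" using z by (auto simp: signs_def s0_def sgn_if)
  have "indicat_real octant (\<sigma> * z) = (if \<sigma> = s0 then 1 else 0)" if "\<sigma> \<in> signs" for \<sigma>
  proof -
    have "\<sigma> * z \<in> octant \<longleftrightarrow> (\<forall>i. \<sigma>$i = sgn (z$i))"
      unfolding octant_def mem_Collect_eq
    proof (rule all_cong1)
      fix i
      have "\<sigma>$i = 1 \<or> \<sigma>$i = -1" using that by (simp add: signs_def)
      moreover have "z$i \<noteq> 0" using z by simp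
      ultimately show "0 \<le> (\<sigma> * z)$i \<longleftrightarrow> \<sigma>$i = sgn (z$i)" by (auto simp: sgn_if)
    qed
    then show ?thesis by (simp add: indicator_def s0_def vec_eq_iff)
  qed
  then have "(\<Sum>\<sigma>\<in>signs. indicat_real octant (\<sigma> * z)) = (\<Sum>\<sigma>\<in>signs. if \<sigma> = s0 then 1 else 0)"
    by (intro sum.cong) auto
  then show ?thesis using s0 by simp
qed

lemma AE_components_nonzero: "AE z in lborel. \<forall>i. (z::real^3)$i \<noteq> 0"
  using AE_lborel_component_notin_countable[of "{0}"] by simp

text \<open>The reflected octants form a partition of unity almost everywhere. In each summand the
  substitution z -> \<open>\<sigma> * z\<close> preserves the measure and, being an involution,
  moves the indicator back to the octant.\<close>

lemma integral_octant_signs: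
  fixes f :: "real^3 \<Rightarrow> real"
  assumes f: "integrable lborel f"
  shows "(LINT z|lborel. f z) = (LINT z:octant|lborel. \<Sum>\<sigma>\<in>signs. f (\<sigma> * z))"
proof -
  have [measurable]: "f \<in> borel_measurable borel" using f by auto
  let ?g = "\<lambda>\<sigma> z. indicat_real octant (\<sigma> * z) * f z"
  have gi: "integrable lborel (?g \<sigma>)" for \<sigma>
    by (rule Bochner_Integration.integrable_bound[OF f]) (auto simp: indicator_def)
  have fi: "set_integrable lborel octant (\<lambda>z. f (\<sigma> * z))" if "\<sigma> \<in> signs" for \<sigma>
    unfolding set_integrable_def
    by (rule integrable_mult_indicator) (auto intro: integrable_lborel_orthogonal[OF signs_mult_orthogonal[OF that] f])
  have "(LINT z|lborel. f z) = (LINT z|lborel. (\<Sum>\<sigma>\<in>signs. ?g \<sigma> z))"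
  proof (rule integral_cong_AE)
    show "AE z in lborel. f z = (\<Sum>\<sigma>\<in>signs. ?g \<sigma> z)"
      using AE_components_nonzero
      by eventually_elim (simp add: sum_distrib_right[symmetric] sum_signs_octant)
  qed measurable
  also have "\<dots> = (\<Sum>\<sigma>\<in>signs. (LINT z|lborel. ?g \<sigma> z))"
    by (rule Bochner_Integration.integral_sum) (rule gi)
  also have "\<dots> = (\<Sum>\<sigma>\<in>signs. (LINT z:octant|lborel. f (\<sigma> * z)))"
  proof (rule sum.cong)
    fix \<sigma> assume s: "\<sigma> \<in> signs"
    have "(LINT z|lborel. ?g \<sigma> z) = (LINT z|lborel. ?g \<sigma> (\<sigma> * z))"
      by (rule integral_lborel_orthogonal[OF signs_mult_orthogonal[OF s], symmetric]) measurable
    then show "(LINT z|lborel. ?g \<sigma> z) = (LINT z:octant|lborel. f (\<sigma> * z))"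
      by (simp add: signs_mult_self[OF s] set_lebesgue_integral_def)
  qed simp
  also have "\<dots> = (LINT z:octant|lborel. \<Sum>\<sigma>\<in>signs. f (\<sigma> * z))"
    by (rule set_integral_sum[symmetric]) (rule fi)
  finally show "(LINT z|lborel. f z) = (LINT z:octant|lborel. \<Sum>\<sigma>\<in>signs. f (\<sigma> * z))" .
qed

text \<open>For each cutoff e > 0 boundedness of u makes the truncated integrand absolutely
  integrable, so it may be folded. Only after folding is there an integrable majorant down to 0, and
  dominated convergence then yields both existence and value of the \<open>Lim\<close>.\<close>

lemma frac_lap_eq_octant_integral:
  assumes um [measurable]: "u \<in> borel_measurable borel" and ub: "\<And>y. \<bar>u y\<bar> \<le> M" and \<alpha>: "0 < \<alpha>"
    and G: "set_integrable lborel octant (\<lambda>z. sym_diff8 u x z * norm z powr (- (3 + \<alpha>)))"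
  shows "frac_lap \<alpha> u x = - c_const \<alpha> * (LINT z:octant|lborel. sym_diff8 u x z * norm z powr (- (3 + \<alpha>)))"
proof -
  let ?G = "\<lambda>z. sym_diff8 u x z * norm z powr (- (3 + \<alpha>))"
  let ?f = "\<lambda>e z. indicat_real {z. e \<le> norm z} z * ((u x - u (x + z)) * norm z powr (- (3 + \<alpha>)))"
  let ?F = "\<lambda>e. LINT y:{y. e \<le> dist x y}|lborel. (u x - u y) / dist x y powr (3 + \<alpha>)"
  have gm [measurable]: "sym_diff8 u x \<in> borel_measurable borel"
    unfolding sym_diff8_def by measurable
  have F: "?F e = - (LINT z:octant|lborel. indicat_real {z. e \<le> norm z} z * ?G z)" if e: "0 < e" for e
  proof -
    have "?F e = (LINT y|distr lborel borel ((+) x). indicator {y. e \<le> dist x y} y *\<^sub>R ((u x - u y) / dist x y powr (3 + \<alpha>)))"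
      by (simp add: lborel_distr_plus set_lebesgue_integral_def)
    also have "\<dots> = (LINT z|lborel. indicator {y. e \<le> dist x y} (x + z) *\<^sub>R ((u x - u (x + z)) / dist x (x + z) powr (3 + \<alpha>)))"
      by (rule integral_distr) measurable
    also have "\<dots> = (LINT z|lborel. ?f e z)"
      by (rule Bochner_Integration.integral_cong)
        (auto simp: indicator_def dist_norm powr_minus divide_inverse simp del: minus_add_distrib)
    also have "\<dots> = (LINT z:octant|lborel. \<Sum>\<sigma>\<in>signs. ?f e (\<sigma> * z))"
    proof (rule integral_octant_signs)
      have i: "set_integrable lborel {z::real^3. e \<le> norm z} (\<lambda>z. 2 * M * norm z powr (- (3 + \<alpha>)))"
        using e \<alpha> by (intro set_integrable_mult_right integrable_norm_powr_at_infinity) auto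
      show "integrable lborel (?f e)"
      proof (rule Bochner_Integration.integrable_bound[OF i[unfolded set_integrable_def]])
        have "norm (?f e z) \<le> norm (indicat_real {z. e \<le> norm z} z *\<^sub>R (2 * M * norm z powr (- (3 + \<alpha>))))" for z
        proof -
          have "\<bar>u x - u (x + z)\<bar> \<le> 2 * M" using ub[of x] ub[of "x + z"] by linarith
          then show ?thesis by (auto simp: indicator_def abs_mult intro!: mult_right_mono)
        qed
        then show "AE z in lborel. norm (?f e z) \<le> norm (indicat_real {z. e \<le> norm z} z *\<^sub>R (2 * M * norm z powr (- (3 + \<alpha>))))"
          by simp
      qed measurable
    qed
    also have "\<dots> = (LINT z:octant|lborel. - (indicat_real {z. e \<le> norm z} z * ?G z))"
    proof (rule arg_cong[where f="set_lebesgue_integral lborel octant"], rule ext)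
      fix z
      have "(\<Sum>\<sigma>\<in>signs. ?f e (\<sigma> * z)) = (\<Sum>\<sigma>\<in>signs. (u x - u (x + \<sigma> * z)) * (indicat_real {z. e \<le> norm z} z * norm z powr (- (3 + \<alpha>))))"
        by (intro sum.cong) (auto simp: indicator_def norm_signs_mult)
      also have "\<dots> = - (indicat_real {z. e \<le> norm z} z * ?G z)"
        by (simp add: sum_distrib_right[symmetric] sum_subtractf card_signs sym_diff8_def algebra_simps)
      finally show "(\<Sum>\<sigma>\<in>signs. ?f e (\<sigma> * z)) = - (indicat_real {z. e \<le> norm z} z * ?G z)" .
    qed
    finally show ?thesis by (simp add: set_lebesgue_integral_def)
  qed
  \<comment> \<open>The cutoff is written as \<open>inverse t\<close>, which turns the limit from
    the right at 0 into one at infinity; each z \<noteq> 0 is eventually inside the truncated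
    region.\<close>
  have "((\<lambda>t. LINT z:octant|lborel. indicat_real {z. inverse t \<le> norm z} z * ?G z) \<longlongrightarrow> (LINT z:octant|lborel. ?G z)) at_top"
    unfolding set_lebesgue_integral_def
  proof (rule integral_dominated_convergence_at_top[where w = "\<lambda>z. norm (indicat_real octant z *\<^sub>R ?G z)"])
    show "integrable lborel (\<lambda>z. norm (indicat_real octant z *\<^sub>R ?G z))"
      using G unfolding set_integrable_def by (rule integrable_norm)
    show "\<forall>\<^sub>F t in at_top. AE z in lborel. norm (indicat_real octant z *\<^sub>R (indicat_real {z. inverse t \<le> norm z} z * ?G z)) \<le> norm (indicat_real octant z *\<^sub>R ?G z)"
      by (intro always_eventually allI AE_I2) (simp add: indicator_def)
    show "AE z in lborel. ((\<lambda>t. indicat_real octant z *\<^sub>R (indicat_real {z. inverse t \<le> norm z} z * ?G z)) \<longlongrightarrow> indicat_real octant z *\<^sub>R ?G z) at_top"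
      using AE_lborel_singleton[of "0::real^3"]
    proof eventually_elim
      case (elim z)
      have "\<forall>\<^sub>F t in at_top. inverse t \<le> norm z"
      proof (rule eventually_mono[OF eventually_ge_at_top[of "inverse (norm z)"]])
        fix t assume t: "inverse (norm z) \<le> t"
        have "0 < inverse (norm z)" using elim by simp
        with t have "inverse t \<le> inverse (inverse (norm z))" by (intro le_imp_inverse_le)
        then show "inverse t \<le> norm z" by simp
      qed
      then have "\<forall>\<^sub>F t in at_top. indicat_real octant z *\<^sub>R (indicat_real {z. inverse t \<le> norm z} z * ?G z) = indicat_real octant z *\<^sub>R ?G z"
        by eventually_elim simp
      then show ?case by (rule tendsto_eventually)
    qed
  qed measurable
  then have "((\<lambda>e. LINT z:octant|lborel. indicat_real {z. e \<le> norm z} z * ?G z) \<longlongrightarrow> (LINT z:octant|lborel. ?G z)) (at_right 0)"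
    by (simp add: filterlim_at_right_to_top)
  then have "((\<lambda>e. - (LINT z:octant|lborel. indicat_real {z. e \<le> norm z} z * ?G z)) \<longlongrightarrow> - (LINT z:octant|lborel. ?G z)) (at_right 0)"
    by (rule tendsto_minus)
  then have "(?F \<longlongrightarrow> - (LINT z:octant|lborel. ?G z)) (at_right 0)"
    by (rule Lim_transform_eventually) (simp add: eventually_at_right_less eventually_at_filter F)
  then have "Lim (at_right 0) ?F = - (LINT z:octant|lborel. ?G z)"
    by (rule tendsto_Lim[rotated]) simp
  then show ?thesis by (simp add: frac_lap_def)
qed

section \<open>Cutting the cube into grid cells\<close>

lemma pt3_nth [simp]: "pt3 a b c $ 1 = a" "pt3 a b c $ 2 = b" "pt3 a b c $ 3 = c"
  by (simp_all add: pt3_def)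

lemma mem_cell:
  "\<xi> \<in> cell h i j k \<longleftrightarrow> \<xi>$1 \<in> {real i * h..real (i+1) * h} \<and> \<xi>$2 \<in> {real j * h..real (j+1) * h} \<and> \<xi>$3 \<in> {real k * h..real (k+1) * h}"
  by (auto simp: cell_def grid_def mem_box_cart forall_3)

text \<open>Adjacent closed intervals share only grid points, which t avoids. For N = 0 the
  right-hand interval is the point 0, itself a grid point.\<close>

lemma sum_indicator_intervals:
  fixes h t :: real
  assumes h: "0 < h" and t: "\<forall>n::nat. t \<noteq> real n * h"
  shows "(\<Sum>i<N. indicat_real {real i * h..real (i+1) * h} t) = indicat_real {0..real N * h} t"
proof (induction N)
  case 0
  then show ?case using t[rule_format, of 0] by (simp add: indicator_def)
next
  case (Suc N)
  have "indicat_real {0..real N * h} t + indicat_real {real N * h..real (N+1) * h} t = indicat_real {0..real (Suc N) * h} t"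
  proof -
    have "0 \<le> real N * h" "real N * h \<le> real (N+1) * h" "t \<noteq> real N * h"
      using h t by (auto simp: algebra_simps)
    then show ?thesis by (auto simp: indicator_def)
  qed
  then show ?case using Suc by simp
qed

definition cells :: "nat \<Rightarrow> (nat \<times> nat \<times> nat) set" where
  "cells N = {0..<N} \<times> {0..<N} \<times> {0..<N}"

definition cube :: "real \<Rightarrow> (real^3) set" where
  "cube L = cbox 0 (pt3 L L L)"

lemma mem_cube: "\<xi> \<in> cube L \<longleftrightarrow> \<xi>$1 \<in> {0..L} \<and> \<xi>$2 \<in> {0..L} \<and> \<xi>$3 \<in> {0..L}"
  by (auto simp: cube_def mem_box_cart forall_3)

lemma cell_measurable [measurable]: "cell h i j k \<in> sets borel"
  by (simp add: cell_def)

lemma cube_measurable [measurable]: "cube L \<in> sets borel"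
  by (simp add: cube_def)

text \<open>The indicator of a cell is a product of three interval indicators, so the sum over all
  cells factors into three one-dimensional sums, valid off the countably many grid
  hyperplanes.\<close>

lemma integral_cube_cells:
  fixes f :: "real^3 \<Rightarrow> real"
  assumes h: "0 < h" and f: "set_integrable lborel (cube (real N * h)) f"
  shows "(LINT \<xi>:cube (real N * h)|lborel. f \<xi>) = (\<Sum>(i,j,k)\<in>cells N. LINT \<xi>:cell h i j k|lborel. f \<xi>)"
proof -
  let ?C = "cube (real N * h)"
  let ?I = "\<lambda>i t. indicat_real {real i * h..real (i+1) * h} t"
  have sub: "cell h i j k \<subseteq> ?C" if "(i,j,k) \<in> cells N" for i j k
  proof
    fix \<xi> assume x: "\<xi> \<in> cell h i j k"
    have *: "real (l + 1) * h \<le> real N * h" "0 \<le> real l * h" if "l < N" for l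
      using that h by (auto intro!: mult_right_mono)
    show "\<xi> \<in> ?C"
      using x that *[of i] *[of j] *[of k] unfolding mem_cell mem_cube cells_def by auto
  qed
  have ci: "set_integrable lborel (cell h i j k) f" if "(i,j,k) \<in> cells N" for i j k
    using set_integrable_subset[OF f _ sub[OF that]] by simp
  have prod: "indicat_real (cell h i j k) \<xi> = ?I i (\<xi>$1) * (?I j (\<xi>$2) * ?I k (\<xi>$3))" for i j k \<xi>
    by (simp add: indicator_def mem_cell)
  have "countable (range (\<lambda>n::nat. real n * h))" by simp
  from AE_lborel_component_notin_countable[OF this]
  have "AE \<xi> in lborel. indicat_real ?C \<xi> *\<^sub>R f \<xi> = (\<Sum>(i,j,k)\<in>cells N. indicat_real (cell h i j k) \<xi> *\<^sub>R f \<xi>)"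
  proof eventually_elim
    case (elim \<xi>)
    have 1: "(\<Sum>i\<in>{0..<N}. ?I i (\<xi>$l)) = indicat_real {0..real N * h} (\<xi>$l)" for l
      using sum_indicator_intervals[OF h, of "\<xi>$l" N] elim by (auto simp: lessThan_atLeast0)
    have "(\<Sum>(i,j,k)\<in>cells N. indicat_real (cell h i j k) \<xi>)
       = (\<Sum>i\<in>{0..<N}. ?I i (\<xi>$1)) * ((\<Sum>j\<in>{0..<N}. ?I j (\<xi>$2)) * (\<Sum>k\<in>{0..<N}. ?I k (\<xi>$3)))"
      unfolding cells_def prod sum.cartesian_product[symmetric] by (simp only: sum_distrib_left[symmetric] sum_distrib_right[symmetric])
    also have "\<dots> = indicat_real ?C \<xi>"
      unfolding 1 by (simp add: indicator_def mem_cube)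
    finally show ?case by (simp add: split_def sum_distrib_right[symmetric])
  qed
  then have "(LINT \<xi>:?C|lborel. f \<xi>) = (LINT \<xi>|lborel. (\<Sum>(i,j,k)\<in>cells N. indicat_real (cell h i j k) \<xi> *\<^sub>R f \<xi>))"
    unfolding set_lebesgue_integral_def
  proof (intro integral_cong_AE)
    show "(\<lambda>\<xi>. indicat_real ?C \<xi> *\<^sub>R f \<xi>) \<in> borel_measurable lborel"
      using f by (simp add: set_integrable_def)
    show "(\<lambda>\<xi>. \<Sum>(i,j,k)\<in>cells N. indicat_real (cell h i j k) \<xi> *\<^sub>R f \<xi>) \<in> borel_measurable lborel"
      using ci by (intro borel_measurable_sum) (auto simp: set_integrable_def)
  qed
  also have "\<dots> = (\<Sum>(i,j,k)\<in>cells N. (LINT \<xi>|lborel. indicat_real (cell h i j k) \<xi> *\<^sub>R f \<xi>))"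
    unfolding split_def
    by (rule Bochner_Integration.integral_sum) (use ci in \<open>auto simp: set_integrable_def\<close>)
  finally show ?thesis by (simp add: set_lebesgue_integral_def)
qed

section \<open>The quadrature rule\<close>

definition weight :: "real \<Rightarrow> real \<Rightarrow> nat \<Rightarrow> nat \<Rightarrow> nat \<Rightarrow> real" where
  "weight \<alpha> h i j k = (LINT \<xi>:cell h i j k|lborel. omega \<alpha> 2 \<xi>)"

definition corners :: "real \<Rightarrow> (real^3 \<Rightarrow> real) \<Rightarrow> nat \<Rightarrow> nat \<Rightarrow> nat \<Rightarrow> real" where
  "corners h f i j k = (\<Sum>m\<in>{0,1::nat}. \<Sum>n\<in>{0,1::nat}. \<Sum>s\<in>{0,1::nat}. f (grid h (i+m) (j+n) (k+s)))"

text \<open>The rule as a linear functional of an arbitrary f, so that it can be applied separately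
  to the parts of \<open>psi 2 u x\<close>. The 1/3 is 1/8 times the coefficient 8/3. For h > 0 the
  origin is never a node: the first cell uses its three axis corners only.\<close>

definition quad :: "real \<Rightarrow> real \<Rightarrow> nat \<Rightarrow> (real^3 \<Rightarrow> real) \<Rightarrow> real" where
  "quad \<alpha> h N f = 1/3 * (f (grid h 1 0 0) + f (grid h 0 1 0) + f (grid h 0 0 1)) * weight \<alpha> h 0 0 0
     + 1/8 * (\<Sum>(i,j,k)\<in>cells N - {(0,0,0)}. corners h f i j k * weight \<alpha> h i j k)"

lemma frac_lap_h_eq_quad:
  "frac_lap_h \<alpha> 2 L N u x = - c_const \<alpha> * (quad \<alpha> (L / real N) N (psi 2 u x)
      - 8 * u x * (LINT \<xi>:D2 L|lborel. norm \<xi> powr (- (3 + \<alpha>))))"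
proof -
  have S: "({0,1} \<times> {0,1} \<times> {0,1::nat}) - {(0,0,0)} =
      {(1::nat,0::nat,0::nat), (0,1,0), (0,0,1), (1,1,0), (1,0,1), (0,1,1), (1,1,1)}" by auto
  have "(\<Sum>(m,n,s)\<in>({0,1} \<times> {0,1} \<times> {0,1}) - {(0,0,0)}. ccoef 2 m n s * f (grid h m n s))
      = 8/3 * (f (grid h 1 0 0) + f (grid h 0 1 0) + f (grid h 0 0 1))" for f :: "real^3 \<Rightarrow> real" and h
    unfolding S by (simp add: ccoef_def)
  then show ?thesis
    by (simp add: frac_lap_h_def quad_def weight_def corners_def cells_def Let_def)
qed

lemma quad_add: "quad \<alpha> h N (\<lambda>\<xi>. f \<xi> + g \<xi>) = quad \<alpha> h N f + quad \<alpha> h N g"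
proof -
  have "corners h (\<lambda>\<xi>. f \<xi> + g \<xi>) i j k = corners h f i j k + corners h g i j k" for i j k
    by (simp add: corners_def)
  then show ?thesis
    unfolding quad_def by (simp add: split_def algebra_simps sum.distrib)
qed

lemma quad_mult: "quad \<alpha> h N (\<lambda>\<xi>. a * f \<xi>) = a * quad \<alpha> h N f"
proof -
  have "corners h (\<lambda>\<xi>. a * f \<xi>) i j k = a * corners h f i j k" for i j k
    by (simp add: corners_def algebra_simps)
  then show ?thesis
    unfolding quad_def by (simp add: split_def algebra_simps sum_distrib_left)
qed

section \<open>Exactness of the rule on the quadratic part\<close>

definition rot :: "real^3 \<Rightarrow> real^3" where "rot \<xi> = pt3 (\<xi>$2) (\<xi>$3) (\<xi>$1)"

lemma rot_nth [simp]: "rot \<xi> $ 1 = \<xi>$2" "rot \<xi> $ 2 = \<xi>$3" "rot \<xi> $ 3 = \<xi>$1"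
  by (simp_all add: rot_def)

lemma norm_rot [simp]: "norm (rot \<xi>) = norm \<xi>"
  by (simp add: norm_eq_sqrt_inner inner_vec_def sum_3 add_ac)

lemma rot_orthogonal: "orthogonal_transformation rot"
  unfolding orthogonal_transformation
proof
  show "linear rot" by (rule linearI) (simp_all add: vec_eq_iff forall_3)
qed simp

lemma rot_grid: "rot (grid h i j k) = grid h j k i"
  by (simp add: grid_def vec_eq_iff forall_3)

lemma omega_rot [simp]: "omega \<alpha> \<gamma> (rot \<xi>) = omega \<alpha> \<gamma> \<xi>"
  by (simp add: omega_def)

lemma weight_rot: "weight \<alpha> h j k i = weight \<alpha> h i j k"
proof -
  have "weight \<alpha> h j k i = (LINT \<xi>|lborel. indicat_real (cell h j k i) (rot \<xi>) *\<^sub>R omega \<alpha> 2 (rot \<xi>))"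
    unfolding weight_def set_lebesgue_integral_def
    by (rule integral_lborel_orthogonal[OF rot_orthogonal, symmetric]) measurable
  also have "\<dots> = weight \<alpha> h i j k"
    unfolding weight_def set_lebesgue_integral_def
    by (rule Bochner_Integration.integral_cong) (auto simp: indicator_def mem_cell)
  finally show ?thesis .
qed

text \<open>The cyclic shift permutes the cells other than the first, preserves their weights, and
  permutes the three axis nodes of the first cell.\<close>

lemma quad_rot: "quad \<alpha> h N (\<lambda>\<xi>. f (rot \<xi>)) = quad \<alpha> h N f"
proof -
  have c: "corners h (\<lambda>\<xi>. f (rot \<xi>)) i j k = corners h f j k i" for i j k
    by (simp add: corners_def rot_grid)
  have "bij_betw (\<lambda>(i,j,k). (j,k,i)) (cells N - {(0,0,0)}) (cells N - {(0,0,0)})"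
    by (rule bij_betw_byWitness[where f' = "\<lambda>(i,j,k). (k,i,j)"]) (auto simp: cells_def)
  note sum.reindex_bij_betw[OF this, of "\<lambda>(i,j,k). corners h f i j k * weight \<alpha> h i j k"]
  moreover have "weight \<alpha> h (fst (snd c)) (snd (snd c)) (fst c) = weight \<alpha> h (fst c) (fst (snd c)) (snd (snd c))" for c
    by (rule weight_rot)
  ultimately have "(\<Sum>(i,j,k)\<in>cells N - {(0,0,0)}. corners h f j k i * weight \<alpha> h i j k)
      = (\<Sum>(i,j,k)\<in>cells N - {(0,0,0)}. corners h f i j k * weight \<alpha> h i j k)"
    by (simp add: split_def)
  then show ?thesis
    unfolding quad_def c by (simp add: rot_grid)
qed

lemma integral_cube_rot:
  assumes [measurable]: "f \<in> borel_measurable borel"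
  shows "(LINT \<xi>:cube L|lborel. f (rot \<xi>) * omega \<alpha> 2 \<xi>) = (LINT \<xi>:cube L|lborel. f \<xi> * omega \<alpha> 2 \<xi>)"
proof -
  have "(LINT \<xi>:cube L|lborel. f \<xi> * omega \<alpha> 2 \<xi>)
     = (LINT \<xi>|lborel. indicat_real (cube L) (rot \<xi>) *\<^sub>R (f (rot \<xi>) * omega \<alpha> 2 (rot \<xi>)))"
    unfolding set_lebesgue_integral_def
    by (rule integral_lborel_orthogonal[OF rot_orthogonal, symmetric]) measurable
  also have "\<dots> = (LINT \<xi>:cube L|lborel. f (rot \<xi>) * omega \<alpha> 2 \<xi>)"
    unfolding set_lebesgue_integral_def
    by (rule Bochner_Integration.integral_cong) (auto simp: indicator_def mem_cube)
  finally show ?thesis by simp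
qed

definition proj2 :: "3 \<Rightarrow> real^3 \<Rightarrow> real" where
  "proj2 i \<xi> = norm \<xi> powr (- 2) * (\<xi>$i)^2"

lemma proj2_measurable [measurable]: "proj2 i \<in> borel_measurable borel"
  unfolding proj2_def by measurable

lemma proj2_bound: "\<bar>proj2 i \<xi>\<bar> \<le> 1"
proof (cases "\<xi> = 0")
  case False
  have "(\<xi>$i)^2 \<le> norm \<xi>^2" using component_le_norm_cart[of \<xi> i] by (metis abs_ge_zero power2_abs power_mono)
  then show ?thesis using False by (simp add: proj2_def powr_minus powr_numeral divide_simps)
qed (simp add: proj2_def)

lemma sum_proj2: "\<xi> \<noteq> 0 \<Longrightarrow> (\<Sum>i\<in>UNIV. proj2 i \<xi>) = 1"
proof -
  assume "\<xi> \<noteq> 0"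
  have "(\<Sum>i\<in>UNIV. (\<xi>$i)^2) = norm \<xi>^2"
    by (simp only: power2_norm_eq_inner inner_vec_def inner_real_def) (simp only: power2_eq_square)
  then have "(\<Sum>i\<in>UNIV. proj2 i \<xi>) = norm \<xi> powr (- 2) * norm \<xi>^2"
    by (simp add: proj2_def sum_distrib_left[symmetric])
  then show ?thesis using \<open>\<xi> \<noteq> 0\<close> by (simp add: powr_minus powr_numeral)
qed

lemma proj2_omega_integrable:
  assumes "0 < \<alpha>" "\<alpha> < 2" "bounded A" "A \<in> sets borel"
  shows "set_integrable lborel A (\<lambda>\<xi>. proj2 i \<xi> * omega \<alpha> 2 \<xi>)"
proof (rule set_integrable_bound[OF omega_set_integrable[OF assms]])
  show "AE \<xi> in lborel. \<xi> \<in> A \<longrightarrow> norm (proj2 i \<xi> * omega \<alpha> 2 \<xi>) \<le> norm (omega \<alpha> 2 \<xi>)"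
    using proj2_bound by (auto simp: abs_mult mult_left_le_one_le)
qed (use assms in \<open>simp add: set_borel_measurable_def\<close>)

text \<open>The node coefficients add up to 1 in every cell (3 times 1/3 in the first, 8 times 1/8
  elsewhere), so a function that is 1 at all nodes is integrated exactly. Applied to the sum of the
  three projections, this gives three times the same number on both sides.\<close>

lemma quad_exact_proj2:
  assumes h: "0 < h" and N: "0 < N" and \<alpha>: "0 < \<alpha>" "\<alpha> < 2"
  shows "quad \<alpha> h N (proj2 i) = (LINT \<xi>:cube (real N * h)|lborel. proj2 i \<xi> * omega \<alpha> 2 \<xi>)"
proof -
  let ?I = "\<lambda>i. LINT \<xi>:cube (real N * h)|lborel. proj2 i \<xi> * omega \<alpha> 2 \<xi>"
  let ?s = "\<lambda>\<xi>. \<Sum>i\<in>UNIV. proj2 i \<xi>"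
  have cb: "bounded (cube (real N * h))" by (simp add: cube_def)
  have r: "proj2 1 (rot \<xi>) = proj2 2 \<xi>" "proj2 2 (rot \<xi>) = proj2 3 \<xi>" for \<xi>
    by (simp_all add: proj2_def)
  have q: "quad \<alpha> h N (proj2 2) = quad \<alpha> h N (proj2 1)" "quad \<alpha> h N (proj2 3) = quad \<alpha> h N (proj2 1)"
    using quad_rot[of \<alpha> h N "proj2 1"] quad_rot[of \<alpha> h N "proj2 2"] unfolding r by simp_all
  have I: "?I 2 = ?I 1" "?I 3 = ?I 1"
    using integral_cube_rot[of "proj2 1" "real N * h" \<alpha>] integral_cube_rot[of "proj2 2" "real N * h" \<alpha>]
    unfolding r by simp_all
  have g0: "grid h i j k \<noteq> 0" if "(i,j,k) \<noteq> (0,0,0)" for i j k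
    using that h by (auto simp: grid_def vec_eq_iff forall_3)
  have "quad \<alpha> h N ?s = weight \<alpha> h 0 0 0 + (\<Sum>(i,j,k)\<in>cells N - {(0,0,0)}. weight \<alpha> h i j k)"
  proof -
    have c8: "corners h ?s i j k = 8" if "(i,j,k) \<noteq> (0,0,0)" for i j k
    proof -
      have "corners h ?s i j k = (\<Sum>m\<in>{0,1::nat}. \<Sum>n\<in>{0,1::nat}. \<Sum>s\<in>{0,1::nat}. 1)"
        unfolding corners_def using that by (intro sum.cong refl sum_proj2 g0) auto
      then show ?thesis by simp
    qed
    have "(case c of (i,j,k) \<Rightarrow> corners h ?s i j k * weight \<alpha> h i j k) = (case c of (i,j,k) \<Rightarrow> 8 * weight \<alpha> h i j k)"
      if "c \<noteq> (0,0,0)" for c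
    proof (cases c)
      case (fields i j k)
      then show ?thesis using c8[of i j k] that by simp
    qed
    then have "(\<Sum>(i,j,k)\<in>cells N - {(0,0,0)}. corners h ?s i j k * weight \<alpha> h i j k)
       = (\<Sum>(i,j,k)\<in>cells N - {(0,0,0)}. 8 * weight \<alpha> h i j k)"
      by (intro sum.cong) simp_all
    then show ?thesis
      unfolding quad_def by (simp add: sum_proj2 g0 split_def sum_distrib_left[symmetric])
  qed
  also have "\<dots> = (\<Sum>(i,j,k)\<in>cells N. weight \<alpha> h i j k)"
  proof -
    have "finite (cells N)" "(0,0,0) \<in> cells N" using N by (auto simp: cells_def)
    then show ?thesis using sum.remove[of "cells N" "(0,0,0)" "\<lambda>(i,j,k). weight \<alpha> h i j k"] by simp
  qed
  also have "\<dots> = (LINT \<xi>:cube (real N * h)|lborel. omega \<alpha> 2 \<xi>)"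
    unfolding weight_def using integral_cube_cells[OF h omega_set_integrable[OF \<alpha> cb]] by simp
  also have "\<dots> = (LINT \<xi>:cube (real N * h)|lborel. (\<Sum>i\<in>UNIV. proj2 i \<xi> * omega \<alpha> 2 \<xi>))"
  proof -
    have "AE \<xi> in lborel. \<xi> \<in> cube (real N * h) \<longrightarrow> omega \<alpha> 2 \<xi> = (\<Sum>i\<in>UNIV. proj2 i \<xi> * omega \<alpha> 2 \<xi>)"
      using AE_lborel_singleton[of "0::real^3"]
      by eventually_elim (simp add: sum_distrib_right[symmetric] sum_proj2)
    then show ?thesis by (intro set_lebesgue_integral_cong_AE) auto
  qed
  also have "\<dots> = (\<Sum>i\<in>UNIV. ?I i)"
    by (intro set_integral_sum proj2_omega_integrable[OF \<alpha> cb]) simp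
  finally have "quad \<alpha> h N ?s = 3 * ?I 1" by (simp add: sum_3 I)
  moreover have "quad \<alpha> h N ?s = 3 * quad \<alpha> h N (proj2 1)"
    by (simp add: sum_3 quad_add q)
  ultimately have "quad \<alpha> h N (proj2 1) = ?I 1" by simp
  then show ?thesis using exhaust_3[of i] q I by (elim disjE) simp_all
qed

text \<open>Corner indices m in {0,1} become signs 2m-1 measured from the cell centre, the form in
  which the centred expansion is stated.\<close>

lemma corners_eq_signs:
  "corners h f i j k = (\<Sum>\<sigma>\<in>signs. f (pt3 ((real i + 1/2) * h) ((real j + 1/2) * h) ((real k + 1/2) * h) + (h/2) *\<^sub>R \<sigma>))"
proof -
  let ?c = "pt3 ((real i + 1/2) * h) ((real j + 1/2) * h) ((real k + 1/2) * h)"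
  have g: "?c + (h/2) *\<^sub>R pt3 (2 * real m - 1) (2 * real n - 1) (2 * real s - 1) = grid h (i+m) (j+n) (k+s)" for m n s
    by (simp add: grid_def vec_eq_iff forall_3 field_simps)
  have "(\<Sum>\<sigma>\<in>signs. f (?c + (h/2) *\<^sub>R \<sigma>))
     = (\<Sum>m\<in>{0,1::nat}. \<Sum>n\<in>{0,1::nat}. \<Sum>s\<in>{0,1::nat}. f (?c + (h/2) *\<^sub>R pt3 (2 * real m - 1) (2 * real n - 1) (2 * real s - 1)))"
    unfolding sum_signs by simp
  then show ?thesis unfolding corners_def g by simp
qed

lemma psi_eq_sym_diff8: "psi 2 u x \<xi> = norm \<xi> powr (- 2) * sym_diff8 u x \<xi>"
proof -
  have g: "pt3 (x$1 + a * \<xi>$1) (x$2 + b * \<xi>$2) (x$3 + c * \<xi>$3) = x + pt3 a b c * \<xi>" for a b c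
    by (simp add: vec_eq_iff forall_3)
  show ?thesis
    unfolding psi_def sym_diff8_def g sum_signs by simp
qed

section \<open>Summing the cell errors of the remainder\<close>

context remainder
begin

text \<open>No cancellation is used: integral and rule are bounded separately, 4 + 4 = 8. On this
  cell |\<xi>| \<le> sqrt(3) h \<le> 2h, so |\<xi>|^(\<epsilon>-1) is at most 4 h^2
  |\<xi>|^(\<epsilon>-3).\<close>

lemma first_cell_error:
  assumes h: "0 < h"
  shows "\<bar>(LINT \<xi>:cell h 0 0 0|lborel. \<phi> \<xi> * omega \<alpha> 2 \<xi>)
       - 1/3 * (\<phi> (grid h 1 0 0) + \<phi> (grid h 0 1 0) + \<phi> (grid h 0 0 1)) * weight \<alpha> h 0 0 0\<bar>
     \<le> 8 * K * h^2 * (LINT \<xi>:cell h 0 0 0|lborel. norm \<xi> powr (\<epsilon> - 3))"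
proof -
  let ?Q = "cell h 0 0 0" and ?J = "LINT \<xi>:cell h 0 0 0|lborel. norm \<xi> powr (\<epsilon> - 3)"
  have Q: "bounded ?Q" "?Q \<in> sets borel" by (auto simp: cell_def)
  have iJ: "set_integrable lborel ?Q (\<lambda>\<xi>. a * norm \<xi> powr (\<epsilon> - 3))" for a
    using Q \<epsilon> by (intro set_integrable_mult_right set_integrable_norm_powr) auto
  have nle: "norm \<xi> \<le> 2 * h" if "\<xi> \<in> ?Q" for \<xi>
  proof -
    have "\<bar>\<xi>$i\<bar> \<le> h" for i
      using that exhaust_3[of i] unfolding mem_cell by auto
    then have "(\<Sum>i\<in>UNIV. (\<xi>$i)^2) \<le> (\<Sum>i\<in>(UNIV::3 set). h^2)"
      by (intro sum_mono) (metis abs_ge_zero power2_abs power_mono)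
    also have "\<dots> \<le> (2 * h)^2" by (simp add: power_mult_distrib)
    also have "(\<Sum>i\<in>UNIV. (\<xi>$i)^2) = norm \<xi>^2"
      by (simp only: power2_norm_eq_inner inner_vec_def inner_real_def) (simp only: power2_eq_square)
    finally show ?thesis using h by (auto intro: power2_le_imp_le)
  qed
  have A: "\<bar>LINT \<xi>:?Q|lborel. \<phi> \<xi> * omega \<alpha> 2 \<xi>\<bar> \<le> 4 * K * h^2 * ?J"
  proof -
    have "\<bar>LINT \<xi>:?Q|lborel. \<phi> \<xi> * omega \<alpha> 2 \<xi>\<bar> \<le> (LINT \<xi>:?Q|lborel. \<bar>\<phi> \<xi> * omega \<alpha> 2 \<xi>\<bar>)"
      by (rule set_integral_abs_le[OF \<phi>_omega_integrable[OF Q]])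
    also have "\<dots> \<le> (LINT \<xi>:?Q|lborel. (4 * K * h^2) * norm \<xi> powr (\<epsilon> - 3))"
    proof (intro set_integral_mono set_integrable_abs \<phi>_omega_integrable[OF Q] iJ)
      fix \<xi> assume x: "\<xi> \<in> ?Q"
      have "norm \<xi> powr (\<epsilon> - 1) = norm \<xi>^2 * norm \<xi> powr (\<epsilon> - 3)"
      proof (cases "\<xi> = 0")
        case False
        then show ?thesis using powr_add[of "norm \<xi>" 2 "\<epsilon> - 3"] by (simp add: powr_numeral)
      qed simp
      also have "\<dots> \<le> (2 * h)^2 * norm \<xi> powr (\<epsilon> - 3)"
        using nle[OF x] by (intro mult_right_mono power_mono) auto
      finally have "K * norm \<xi> powr (\<epsilon> - 1) \<le> K * ((2 * h)^2 * norm \<xi> powr (\<epsilon> - 3))"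
        using K by (rule mult_left_mono)
      then show "\<bar>\<phi> \<xi> * omega \<alpha> 2 \<xi>\<bar> \<le> (4 * K * h^2) * norm \<xi> powr (\<epsilon> - 3)"
        using \<phi>_omega_bound[of \<xi>] by (simp add: power_mult_distrib mult_ac)
    qed
    finally show ?thesis by simp
  qed
  \<comment> \<open>The exponent 2-\<alpha>-\<epsilon> is nonnegative, so this power of |\<xi>| may
    be replaced by the same power of 2h.\<close>
  have W: "0 \<le> weight \<alpha> h 0 0 0" "weight \<alpha> h 0 0 0 \<le> (2 * h) powr (2 - \<alpha> - \<epsilon>) * ?J"
  proof -
    show "0 \<le> weight \<alpha> h 0 0 0"
      unfolding weight_def set_lebesgue_integral_def by (rule integral_nonneg_AE) (simp add: omega_def)
    have "weight \<alpha> h 0 0 0 \<le> (LINT \<xi>:?Q|lborel. (2 * h) powr (2 - \<alpha> - \<epsilon>) * norm \<xi> powr (\<epsilon> - 3))"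
      unfolding weight_def
    proof (intro set_integral_mono omega_set_integrable[OF \<alpha> Q] iJ)
      fix \<xi> assume x: "\<xi> \<in> ?Q"
      have "omega \<alpha> 2 \<xi> = norm \<xi> powr ((2 - \<alpha> - \<epsilon>) + (\<epsilon> - 3))" by (simp add: omega_def)
      also have "\<dots> = norm \<xi> powr (2 - \<alpha> - \<epsilon>) * norm \<xi> powr (\<epsilon> - 3)" by (rule powr_add)
      also have "\<dots> \<le> (2 * h) powr (2 - \<alpha> - \<epsilon>) * norm \<xi> powr (\<epsilon> - 3)"
        using nle[OF x] \<epsilon> by (intro mult_right_mono powr_mono2) auto
      finally show "omega \<alpha> 2 \<xi> \<le> (2 * h) powr (2 - \<alpha> - \<epsilon>) * norm \<xi> powr (\<epsilon> - 3)" .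
    qed
    then show "weight \<alpha> h 0 0 0 \<le> (2 * h) powr (2 - \<alpha> - \<epsilon>) * ?J" by simp
  qed
  have B: "\<bar>1/3 * (\<phi> (grid h 1 0 0) + \<phi> (grid h 0 1 0) + \<phi> (grid h 0 0 1)) * weight \<alpha> h 0 0 0\<bar> \<le> 4 * K * h^2 * ?J"
  proof -
    have n: "norm (grid h 1 0 0) = h" "norm (grid h 0 1 0) = h" "norm (grid h 0 0 1) = h"
      using h by (simp_all add: norm_eq_sqrt_inner inner_vec_def sum_3 grid_def)
    have "\<bar>1/3 * (\<phi> (grid h 1 0 0) + \<phi> (grid h 0 1 0) + \<phi> (grid h 0 0 1))\<bar> \<le> K * h powr (\<alpha> + \<epsilon>)"
    proof -
      have "\<bar>1/3 * (p + q + r)\<bar> \<le> B" if "\<bar>p\<bar> \<le> B" "\<bar>q\<bar> \<le> B" "\<bar>r\<bar> \<le> B" for p q r B :: real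
        using that by (simp add: abs_le_iff)
      then show ?thesis
        using \<phi>_bound[of "grid h 1 0 0"] \<phi>_bound[of "grid h 0 1 0"] \<phi>_bound[of "grid h 0 0 1"]
        unfolding n by blast
    qed
    \<comment> \<open>h is enlarged to 2h so that the two powers multiply to exactly (2h)^2.\<close>
    also have "\<dots> \<le> K * (2 * h) powr (\<alpha> + \<epsilon>)"
      using K h \<alpha> \<epsilon> by (intro mult_left_mono powr_mono2) auto
    finally have "\<bar>1/3 * (\<phi> (grid h 1 0 0) + \<phi> (grid h 0 1 0) + \<phi> (grid h 0 0 1)) * weight \<alpha> h 0 0 0\<bar>
       \<le> (K * (2 * h) powr (\<alpha> + \<epsilon>)) * ((2 * h) powr (2 - \<alpha> - \<epsilon>) * ?J)"
      unfolding abs_mult[of _ "weight \<alpha> h 0 0 0"] using W K by (intro mult_mono) auto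
    also have "\<dots> = K * ((2 * h) powr (\<alpha> + \<epsilon>) * (2 * h) powr (2 - \<alpha> - \<epsilon>)) * ?J" by simp
    also have "(2 * h) powr (\<alpha> + \<epsilon>) * (2 * h) powr (2 - \<alpha> - \<epsilon>) = 4 * h^2"
      unfolding powr_add[symmetric] using h by (simp add: powr_numeral power_mult_distrib)
    finally show ?thesis by simp
  qed
  show ?thesis using A B by linarith
qed

text \<open>Each cell error is bounded by the integral of one fixed function over that cell, so the
  sum is a single integral over the cube. It is finite because \<epsilon> > 0, and it depends only
  on the size of the cube.\<close>

lemma quad_error:
  assumes h: "0 < h" and N: "0 < N"
  shows "\<bar>(LINT \<xi>:cube (real N * h)|lborel. \<phi> \<xi> * omega \<alpha> 2 \<xi>) - quad \<alpha> h N \<phi>\<bar>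
     \<le> 20000 * K * h^2 * (LINT \<xi>:cube (real N * h)|lborel. norm \<xi> powr (\<epsilon> - 3))"
proof -
  let ?J = "\<lambda>(i,j,k). LINT \<xi>:cell h i j k|lborel. norm \<xi> powr (\<epsilon> - 3)"
  let ?I = "\<lambda>(i,j,k). LINT \<xi>:cell h i j k|lborel. \<phi> \<xi> * omega \<alpha> 2 \<xi>"
  let ?T = "\<lambda>(i,j,k). if (i,j,k) = (0,0,0)
     then 1/3 * (\<phi> (grid h 1 0 0) + \<phi> (grid h 0 1 0) + \<phi> (grid h 0 0 1)) * weight \<alpha> h 0 0 0
     else 1/8 * corners h \<phi> i j k * weight \<alpha> h i j k"
  have cb: "bounded (cube (real N * h))" by (simp add: cube_def)
  have fin: "finite (cells N)" "(0,0,0) \<in> cells N" using N by (auto simp: cells_def)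
  have q: "quad \<alpha> h N \<phi> = sum ?T (cells N)"
  proof -
    have "sum ?T (cells N - {(0,0,0)}) = 1/8 * (\<Sum>(i,j,k)\<in>cells N - {(0,0,0)}. corners h \<phi> i j k * weight \<alpha> h i j k)"
      unfolding sum_distrib_left
    proof (rule sum.cong)
      fix c assume "c \<in> cells N - {(0,0,0)}"
      then have "c \<noteq> (0,0,0)" by simp
      then show "?T c = 1/8 * (case c of (i,j,k) \<Rightarrow> corners h \<phi> i j k * weight \<alpha> h i j k)"
        by (cases c) (simp only: prod.case if_False mult.assoc)
    qed simp
    then show ?thesis unfolding quad_def using sum.remove[OF fin, of ?T] by simp
  qed
  have cell: "\<bar>?I c - ?T c\<bar> \<le> 20000 * K * h^2 * ?J c" if "c \<in> cells N" for c
  proof -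
    obtain i j k where c: "c = (i,j,k)" by (cases c)
    have J0: "0 \<le> ?J c" unfolding c set_lebesgue_integral_def by (auto intro: integral_nonneg_AE)
    show ?thesis
    proof (cases "c = (0,0,0)")
      case True
      have "8 * K * h^2 * ?J c \<le> 20000 * K * h^2 * ?J c"
        using J0 K by (intro mult_right_mono) auto
      then show ?thesis using first_cell_error[OF h] True by simp
    next
      case False
      define m where "m = pt3 ((real i + 1/2) * h) ((real j + 1/2) * h) ((real k + 1/2) * h)"
      have Q: "cell h i j k = cbox (m - pt3 (h/2) (h/2) (h/2)) (m + pt3 (h/2) (h/2) (h/2))"
      proof -
        have "m - pt3 (h/2) (h/2) (h/2) = grid h i j k" "m + pt3 (h/2) (h/2) (h/2) = grid h (i+1) (j+1) (k+1)"
          by (simp_all add: m_def grid_def vec_eq_iff forall_3 algebra_simps)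
        then show ?thesis by (simp add: cell_def)
      qed
      \<comment> \<open>Some index is at least 1, so the corresponding coordinate of the centre is
        at least (1 + 1/2) h.\<close>
      have "3/2 * h \<le> norm m"
      proof -
        have "3/2 * h \<le> (real l + 1/2) * h" if "0 < l" for l
          using that h by (intro mult_right_mono) auto
        moreover have "m$1 \<le> norm m" "m$2 \<le> norm m" "m$3 \<le> norm m"
          using component_le_norm_cart[of m] by (meson abs_le_D1)+
        moreover have "0 < i \<or> 0 < j \<or> 0 < k" using False c by auto
        ultimately show ?thesis unfolding m_def pt3_nth by (meson order_trans)
      qed
      note cell_quadrature_error[OF this h, folded Q]
      moreover have "?T c = 1/8 * corners h \<phi> i j k * weight \<alpha> h i j k"
        using False unfolding c by (simp only: prod.case if_False)
      ultimately show ?thesis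
        unfolding corners_eq_signs weight_def m_def[symmetric] by (simp only: c prod.case)
    qed
  qed
  have eq: "(LINT \<xi>:cube (real N * h)|lborel. \<phi> \<xi> * omega \<alpha> 2 \<xi>) - quad \<alpha> h N \<phi> = (\<Sum>c\<in>cells N. ?I c - ?T c)"
    unfolding q sum_subtractf using integral_cube_cells[OF h \<phi>_omega_integrable[OF cb]] by simp
  have "\<bar>\<Sum>c\<in>cells N. ?I c - ?T c\<bar> \<le> (\<Sum>c\<in>cells N. 20000 * K * h^2 * ?J c)"
    by (rule order_trans[OF sum_abs sum_mono]) (rule cell)
  also have "\<dots> = 20000 * K * h^2 * (LINT \<xi>:cube (real N * h)|lborel. norm \<xi> powr (\<epsilon> - 3))"
  proof -
    have "set_integrable lborel (cube (real N * h)) (\<lambda>\<xi>. norm \<xi> powr (\<epsilon> - 3))"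
      using \<epsilon> cb by (intro set_integrable_norm_powr) auto
    from integral_cube_cells[OF h this] show ?thesis by (simp add: sum_distrib_left[symmetric])
  qed
  finally show ?thesis unfolding eq .
qed

end

section \<open>Assembling the error bound for the operator\<close>

lemma AE_D2_eq: "AE \<xi> in lborel. \<xi> \<in> D2 L \<longleftrightarrow> \<xi> \<in> octant - cube L"
  using AE_lborel_component_notin_countable[of "{0,L}", simplified]
proof eventually_elim
  case (elim \<xi>)
  \<comment> \<open>\<open>D2\<close> removes an open box and \<open>cube\<close> is closed; the
    difference lies in the faces excluded here.\<close>
  then have "\<xi>$i \<noteq> 0" "\<xi>$i \<noteq> L" for i by auto
  then show ?case
    unfolding D2_def octant_def by (auto simp: mem_box_cart mem_cube forall_3 less_le)
qed

lemma far_component: "\<xi> \<in> octant - cube L \<Longrightarrow> \<exists>i. L < \<xi>$i"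
  by (rule ccontr) (auto simp: octant_def mem_cube not_less)

text \<open>Outside the cube the integrand is exactly -8 u(x) times the kernel, which is the
  \<open>D2\<close> term of the discrete operator; inside, the quadratic part is integrated exactly.
  Hence the whole error is the quadrature error of \<phi>.\<close>

lemma frac_lap_error_bound:
  assumes \<alpha>: "0 < \<alpha>" "\<alpha> < 2" and L: "0 < L" and N: "0 < N"
    and um: "u \<in> borel_measurable borel" and ub: "\<And>y. \<bar>u y\<bar> \<le> M"
    and out: "\<And>\<xi> i. \<xi> \<in> octant \<Longrightarrow> L < \<xi>$i \<Longrightarrow> sym_diff8 u x \<xi> = - 8 * u x"
    and rem: "remainder \<alpha> \<epsilon> K (sym_rem u x) F"
  shows "\<bar>frac_lap \<alpha> u x - frac_lap_h \<alpha> 2 L N u x\<bar>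
    \<le> \<bar>c_const \<alpha>\<bar> * (20000 * K * (L / real N)^2 * (LINT \<xi>:cube L|lborel. norm \<xi> powr (\<epsilon> - 3)))"
proof -
  interpret remainder \<alpha> \<epsilon> K "sym_rem u x" F by (rule rem)
  let ?h = "L / real N"
  have h: "0 < ?h" and Nh: "real N * ?h = L" using L N by auto
  let ?w = "\<lambda>\<xi>::real^3. norm \<xi> powr (- (3 + \<alpha>))"
  let ?G = "\<lambda>\<xi>. sym_diff8 u x \<xi> * ?w \<xi>"
  have cb: "bounded (cube L)" by (simp add: cube_def)
  have psi: "psi 2 u x = (\<lambda>\<xi>. \<phi> \<xi> + (\<Sum>i\<in>UNIV. 4 * pd [i,i] u x * proj2 i \<xi>))"
    by (rule ext) (simp add: psi_eq_sym_diff8 \<phi>_def sym_rem_def proj2_def sum_distrib_left algebra_simps del: pd.simps)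
  have Gpsi: "?G \<xi> = \<phi> \<xi> * omega \<alpha> 2 \<xi> + (\<Sum>i\<in>UNIV. 4 * pd [i,i] u x * (proj2 i \<xi> * omega \<alpha> 2 \<xi>))" for \<xi>
  proof -
    have "?w \<xi> = norm \<xi> powr (- 2) * omega \<alpha> 2 \<xi>"
      unfolding omega_def powr_add[symmetric] by simp
    then have "?G \<xi> = psi 2 u x \<xi> * omega \<alpha> 2 \<xi>" by (simp add: psi_eq_sym_diff8)
    then show ?thesis unfolding psi by (simp add: algebra_simps sum_distrib_left sum_distrib_right del: pd.simps)
  qed
  have pi: "set_integrable lborel (cube L) (\<lambda>\<xi>. \<Sum>i\<in>UNIV. 4 * pd [i,i] u x * (proj2 i \<xi> * omega \<alpha> 2 \<xi>))"
    by (intro set_integrable_sum set_integrable_mult_right proj2_omega_integrable \<alpha> cb) simp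
  have \<phi>i: "set_integrable lborel (cube L) (\<lambda>\<xi>. \<phi> \<xi> * omega \<alpha> 2 \<xi>)"
    by (rule \<phi>_omega_integrable[OF cb]) simp
  have Gi1: "set_integrable lborel (cube L) ?G"
    unfolding Gpsi by (intro set_integral_add \<phi>i pi)
  have exact: "(LINT \<xi>:cube L|lborel. \<Sum>i\<in>UNIV. 4 * pd [i,i] u x * (proj2 i \<xi> * omega \<alpha> 2 \<xi>))
      = (\<Sum>i\<in>UNIV. 4 * pd [i,i] u x * quad \<alpha> ?h N (proj2 i))"
  proof -
    have "(LINT \<xi>:cube L|lborel. \<Sum>i\<in>UNIV. 4 * pd [i,i] u x * (proj2 i \<xi> * omega \<alpha> 2 \<xi>))
      = (\<Sum>i\<in>UNIV. LINT \<xi>:cube L|lborel. 4 * pd [i,i] u x * (proj2 i \<xi> * omega \<alpha> 2 \<xi>))"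
      by (intro set_integral_sum set_integrable_mult_right proj2_omega_integrable \<alpha> cb) simp
    then show ?thesis
      unfolding quad_exact_proj2[OF h N \<alpha>] Nh by (simp del: pd.simps)
  qed
  have quad_psi: "quad \<alpha> ?h N (psi 2 u x) = quad \<alpha> ?h N \<phi> + (\<Sum>i\<in>UNIV. 4 * pd [i,i] u x * quad \<alpha> ?h N (proj2 i))"
    unfolding psi by (simp add: sum_3 quad_add quad_mult del: pd.simps)
  have G1: "(LINT \<xi>:cube L|lborel. ?G \<xi>) - quad \<alpha> ?h N (psi 2 u x) = (LINT \<xi>:cube L|lborel. \<phi> \<xi> * omega \<alpha> 2 \<xi>) - quad \<alpha> ?h N \<phi>"
    unfolding Gpsi quad_psi using set_integral_add(2)[OF \<phi>i pi] exact by simp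
  have out': "?G \<xi> = - 8 * u x * ?w \<xi>" if "\<xi> \<in> octant - cube L" for \<xi>
  proof -
    obtain i where "L < \<xi>$i" using far_component[OF \<open>\<xi> \<in> octant - cube L\<close>] by blast
    then show ?thesis using out[of \<xi> i] that by simp
  qed
  have wi: "set_integrable lborel (octant - cube L) (\<lambda>\<xi>. - 8 * u x * ?w \<xi>)"
  proof -
    have "octant - cube L \<subseteq> {\<xi>. L \<le> norm \<xi>}"
    proof
      fix \<xi> assume "\<xi> \<in> octant - cube L"
      then obtain i where "L < \<xi>$i" using far_component by blast
      then show "\<xi> \<in> {\<xi>. L \<le> norm \<xi>}" using component_le_norm_cart[of \<xi> i] by simp
    qed
    then show ?thesis
      using set_integrable_subset[OF integrable_norm_powr_at_infinity[of "3 + \<alpha>" L], of "octant - cube L"] \<alpha> L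
      by (intro set_integrable_mult_right) auto
  qed
  have Gi2: "set_integrable lborel (octant - cube L) ?G"
    using wi out' by (subst set_integrable_cong[OF refl]) auto
  have oc: "octant = cube L \<union> (octant - cube L)" "cube L \<inter> (octant - cube L) = {}"
    unfolding octant_def by (auto simp: mem_cube forall_3)
  have Gi: "set_integrable lborel octant ?G"
    by (subst oc(1), rule set_integrable_Un[OF Gi1 Gi2]) auto
  have "(LINT \<xi>:octant|lborel. ?G \<xi>) = (LINT \<xi>:cube L|lborel. ?G \<xi>) + (LINT \<xi>:octant - cube L|lborel. ?G \<xi>)"
    by (subst oc(1), rule set_integral_Un[OF oc(2) Gi1 Gi2])
  also have "(LINT \<xi>:octant - cube L|lborel. ?G \<xi>) = (LINT \<xi>:octant - cube L|lborel. - 8 * u x * ?w \<xi>)"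
    using out' by (intro set_lebesgue_integral_cong) auto
  also have "\<dots> = - 8 * u x * (LINT \<xi>:octant - cube L|lborel. ?w \<xi>)"
    by (rule set_integral_mult_right)
  also have "(LINT \<xi>:octant - cube L|lborel. ?w \<xi>) = (LINT \<xi>:D2 L|lborel. ?w \<xi>)"
  proof -
    have "octant - box 0 (pt3 L L L) \<in> sets borel" by auto
    then have [measurable]: "D2 L \<in> sets borel" by (simp add: D2_def octant_def)
    show ?thesis unfolding set_lebesgue_integral_def
    proof (rule integral_cong_AE)
      show "AE \<xi> in lborel. indicat_real (octant - cube L) \<xi> *\<^sub>R ?w \<xi> = indicat_real (D2 L) \<xi> *\<^sub>R ?w \<xi>"
        using AE_D2_eq[of L] by eventually_elim (simp add: indicator_def)
    qed measurable
  qed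
  finally have G: "(LINT \<xi>:octant|lborel. ?G \<xi>) = (LINT \<xi>:cube L|lborel. ?G \<xi>) + - 8 * u x * (LINT \<xi>:D2 L|lborel. ?w \<xi>)" .
  have "frac_lap \<alpha> u x - frac_lap_h \<alpha> 2 L N u x
     = - c_const \<alpha> * ((LINT \<xi>:cube L|lborel. ?G \<xi>) - quad \<alpha> ?h N (psi 2 u x))"
    unfolding frac_lap_eq_octant_integral[OF um ub \<alpha>(1) Gi] G frac_lap_h_eq_quad by (simp add: algebra_simps)
  also have "\<dots> = - c_const \<alpha> * ((LINT \<xi>:cube L|lborel. \<phi> \<xi> * omega \<alpha> 2 \<xi>) - quad \<alpha> ?h N \<phi>)"
    unfolding G1 ..
  finally show ?thesis
    using quad_error[OF h N] unfolding Nh by (simp add: abs_mult mult_left_mono)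
qed

lemma bounded_zero_outside_box:
  fixes u :: "real^3 \<Rightarrow> real"
  assumes cont: "continuous_on UNIV u" and zero: "\<forall>x. x \<notin> box a b \<longrightarrow> u x = 0"
  obtains M where "\<And>y. \<bar>u y\<bar> \<le> M"
proof -
  have "bounded (u ` cbox a b)"
    by (intro compact_imp_bounded compact_continuous_image compact_cbox continuous_on_subset[OF cont]) simp
  then obtain M where M: "\<And>y. y \<in> cbox a b \<Longrightarrow> \<bar>u y\<bar> \<le> M"
    by (auto simp: bounded_iff)
  have "\<bar>u y\<bar> \<le> max M 0" for y
  proof (cases "y \<in> cbox a b")
    case True
    then show ?thesis using M[of y] by simp
  next
    case False
    then have "y \<notin> box a b" using box_subset_cbox by blast
    then show ?thesis using zero by simp
  qed
  then show thesis by (rule that)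
qed

text \<open>The upper bound on \<epsilon> gives \<alpha>+\<epsilon> \<le> 1+floor(\<alpha>) \<le> 2,
  and \<epsilon> \<le> 1 because floor(\<alpha>) \<le> \<alpha>. One K serves all x.\<close>

lemma remainder_sym_rem:
  assumes \<alpha>: "0 < \<alpha>" "\<alpha> < 2" and \<epsilon>: "0 < \<epsilon>" "\<epsilon> \<le> 1 + of_int \<lfloor>\<alpha>\<rfloor> - \<alpha>"
    and u: "u \<in> holder_C (2 + nat \<lfloor>\<alpha>\<rfloor>) (\<alpha> - of_int \<lfloor>\<alpha>\<rfloor> + \<epsilon>)"
    and um: "u \<in> borel_measurable borel"
  obtains K where "K \<ge> 0" "\<And>x. remainder \<alpha> \<epsilon> K (sym_rem u x) (sym_rem_d u x)"
proof -
  obtain K where K: "K \<ge> 0"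
    "\<And>x \<xi>. \<bar>sym_rem u x \<xi>\<bar> \<le> K * norm \<xi> powr (\<alpha> + \<epsilon>) * norm \<xi>^2"
    "\<And>x i \<xi>. \<bar>sym_rem_d u x i \<xi>\<bar> \<le> K * norm \<xi> powr (\<alpha> + \<epsilon>) * norm \<xi>"
    "\<And>x c z. \<bar>sym_rem u x (c + z) - sym_rem u x c - (\<Sum>i\<in>UNIV. sym_rem_d u x i c * z$i)\<bar>
        \<le> K * (norm c + norm z) powr (\<alpha> + \<epsilon>) * norm z^2"
    using sym_rem_estimates[OF \<alpha> \<epsilon>(1) u] by blast
  have "\<lfloor>\<alpha>\<rfloor> \<le> 1" using \<alpha>(2) by linarith
  then have fl: "of_int \<lfloor>\<alpha>\<rfloor> \<le> \<alpha>" "of_int \<lfloor>\<alpha>\<rfloor> \<le> (1::real)"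
    by simp_all
  have sum: "\<alpha> + \<epsilon> \<le> 2" "\<epsilon> \<le> 1" using \<epsilon>(2) fl by linarith+
  have m: "sym_rem u x \<in> borel_measurable borel" for x
  proof -
    have "(\<lambda>\<xi>. u (x + \<sigma> * \<xi>)) \<in> borel_measurable borel" for \<sigma>
      using um by measurable
    then show ?thesis unfolding sym_rem_def sym_diff8_def by measurable
  qed
  show thesis
    by (rule that[OF K(1)], unfold remainder_def) (intro conjI allI \<alpha> \<epsilon> sum m K)
qed

text \<open>L is at least every side length, so moving x by more than L in one coordinate leaves the
  box in either direction, and u vanishes at all eight reflected points.\<close>

lemma sym_diff8_outside_box:
  assumes zero: "\<forall>x. x \<notin> box a b \<longrightarrow> u x = 0" and L: "\<And>i. b$i - a$i \<le> L"
    and x: "x \<in> box a b" and \<xi>: "L < \<xi>$i"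
  shows "sym_diff8 u x \<xi> = - 8 * u x"
proof -
  have "u (x + \<sigma> * \<xi>) = 0" if s: "\<sigma> \<in> signs" for \<sigma>
  proof -
    have "\<sigma>$i = 1 \<or> \<sigma>$i = -1" using s by (simp add: signs_def)
    moreover have "a$i < x$i" "x$i < b$i" using x by (auto simp: mem_box_cart)
    ultimately have "\<not> (a$i < (x + \<sigma> * \<xi>)$i \<and> (x + \<sigma> * \<xi>)$i < b$i)"
      using L[of i] \<xi> by auto
    then have "x + \<sigma> * \<xi> \<notin> box a b" by (auto simp: mem_box_cart)
    then show ?thesis using zero by blast
  qed
  then show ?thesis by (simp add: sym_diff8_def)
qed

theorem theorem4:
  fixes \<alpha> \<epsilon> a1 b1 a2 b2 a3 b3 :: real and u :: "real^3 \<Rightarrow> real"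
  assumes "0 < \<alpha>" and "\<alpha> < 2"
    and "a1 < b1" and "a2 < b2" and "a3 < b3"
    and "\<forall>x. x \<notin> box (pt3 a1 a2 a3) (pt3 b1 b2 b3) \<longrightarrow> u x = 0"
    and "0 < \<epsilon>" and "\<epsilon> \<le> 1 + of_int \<lfloor>\<alpha>\<rfloor> - \<alpha>"
    and "u \<in> holder_C (2 + nat \<lfloor>\<alpha>\<rfloor>) (\<alpha> - of_int \<lfloor>\<alpha>\<rfloor> + \<epsilon>)"
  shows "let L = max (b1 - a1) (max (b2 - a2) (b3 - a3)) in
    \<exists>C>0. \<exists>h0>0. \<forall>N::nat. 0 < N \<and> L / real N \<le> h0 \<longrightarrow>
      (\<forall>x\<in>box (pt3 a1 a2 a3) (pt3 b1 b2 b3).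
         \<bar>frac_lap \<alpha> u x - frac_lap_h \<alpha> 2 L N u x\<bar> \<le> C * (L / real N)^2)"
proof -
  let ?\<Omega> = "box (pt3 a1 a2 a3) (pt3 b1 b2 b3)"
  define L where "L = max (b1 - a1) (max (b2 - a2) (b3 - a3))"
  have L: "0 < L" using assms(3) by (auto simp: L_def)
  have side: "pt3 b1 b2 b3$i - pt3 a1 a2 a3$i \<le> L" for i
    using exhaust_3[of i] by (auto simp: L_def)
  have cont: "continuous_on UNIV u"
    using assms(9) unfolding holder_C_def by (auto dest!: spec[where x="[]"])
  have um: "u \<in> borel_measurable borel" using cont by (rule borel_measurable_continuous_onI)
  obtain M where ub: "\<And>y. \<bar>u y\<bar> \<le> M"
    using bounded_zero_outside_box[OF cont assms(6)] by blast
  obtain K where K: "K \<ge> 0" and rem: "\<And>x. remainder \<alpha> \<epsilon> K (sym_rem u x) (sym_rem_d u x)"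
    using remainder_sym_rem[OF assms(1,2,7-9) um] by blast
  let ?J = "LINT \<xi>:cube L|lborel. norm \<xi> powr (\<epsilon> - 3)"
  let ?C = "\<bar>c_const \<alpha>\<bar> * (20000 * K * ?J)"
  have J: "0 \<le> ?J" unfolding set_lebesgue_integral_def by (auto intro: integral_nonneg_AE)
  \<comment> \<open>The summand 1 only makes the final constant strictly positive.\<close>
  have est: "\<bar>frac_lap \<alpha> u x - frac_lap_h \<alpha> 2 L N u x\<bar> \<le> (1 + ?C) * (L / real N)^2"
    if N: "0 < N" and x: "x \<in> ?\<Omega>" for N :: nat and x
  proof -
    have "\<bar>frac_lap \<alpha> u x - frac_lap_h \<alpha> 2 L N u x\<bar> \<le> \<bar>c_const \<alpha>\<bar> * (20000 * K * (L / real N)^2 * ?J)"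
      by (rule frac_lap_error_bound[OF assms(1,2) L N um ub sym_diff8_outside_box[OF assms(6) side x] rem])
    also have "\<dots> = ?C * (L / real N)^2" by simp
    also have "\<dots> \<le> (1 + ?C) * (L / real N)^2" by (intro mult_right_mono) auto
    finally show ?thesis .
  qed
  have "0 < 1 + ?C" using J K by (intro add_pos_nonneg mult_nonneg_nonneg) auto
  \<comment> \<open>The estimate holds for every positive N, so any positive threshold
    \<open>h0\<close> serves; 1 is taken.\<close>
  with est show ?thesis
    unfolding Let_def L_def[symmetric] by (intro exI[of _ "1 + ?C"] exI[of _ 1] conjI) auto
qed

end
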